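(* Let $K\subseteq\mathbb{R}^n$ be a compact convex subset with non-empty interior. Then $$\Omega:=\{\phi-\operatorname{id}_K:\phi\in\operatorname{Diff}_{\partial K}(K)\}$$ is an open $0$-neighbourhood in $C^\infty_{\partial K}(K,\mathbb{R}^n)$.
   Context: A map $\gamma\colon K\to\mathbb{R}^n$ is smooth if it is continuous, its restriction to the interior $K^0$ is smooth, and all iterated directional derivatives $d^{(k)}(\gamma|_{K^0})\colon K^0\times(\mathbb{R}^n)^k\to\mathbb{R}^n$, $d^{(k)}\gamma(x,y_1,\dots,y_k)=(D_{y_k}\cdots D_{y_1}\gamma)(x)$, admit continuous extensions $d^{(k)}\gamma\colon K\times(\mathbb{R}^n)^k\to\mathbb{R}^n$. The space $C^\infty(K,\mathbb{R}^n)$ of smooth maps carries the smooth compact-open topology, i.e. the initial topology with respect to the maps $\gamma\mapsto d^{(k)}\gamma\in C(K\times(\mathbb{R}^n)^k,\mathbb{R}^n)$, $k\in\mathbb{N}_0$ ($d^{(0)}\gamma=\gamma$), with compact-open topologies on the targets. $C^\infty_{\partial K}(K,\mathbb{R}^n):=\{\eta\in C^\infty(K,\mathbb{R}^n):\eta|_{\partial K}=0\}$ carries the induced topology. $\operatorname{Diff}_{\partial K}(K)$ is the group of all bijections $\phi\colon K\to K$ such that $\phi$ and $\phi^{-1}$ are smooth and $\phi(x)=x$ for all $x\in\partial K$. *)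

theory Defs
  imports "HOL-Analysis.Analysis"
begin

text \<open>
  Maps defined on a subset of a type are represented by extensional functions, i.e. functions
  that take the value \<^term>\<open>undefined\<close> off their domain, so that equality of such functions
  is equality of maps.
\<close>

primrec Ck_on :: "nat \<Rightarrow> 'a::euclidean_space set \<Rightarrow> ('a \<Rightarrow> 'b::euclidean_space) \<Rightarrow> bool" where
  "Ck_on 0 U f \<longleftrightarrow> continuous_on U f"
| "Ck_on (Suc k) U f \<longleftrightarrow>
     (\<forall>x\<in>U. f differentiable (at x)) \<and> (\<forall>v. Ck_on k U (\<lambda>x. frechet_derivative f (at x) v))"

definition smooth_on_open :: "'a::euclidean_space set \<Rightarrow> ('a \<Rightarrow> 'b::euclidean_space) \<Rightarrow> bool" where
  "smooth_on_open U f \<longleftrightarrow> (\<forall>k. Ck_on k U f)"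

definition dir_deriv ::
    "'a::euclidean_space \<Rightarrow> ('a \<Rightarrow> 'b::euclidean_space) \<Rightarrow> 'a \<Rightarrow> 'b" where
  "dir_deriv y f x = vector_derivative (\<lambda>t. f (x + t *\<^sub>R y)) (at 0)"

text \<open>
  Tuples of directions are indexed from \<open>0\<close>, with \<open>y 0\<close> the direction differentiated first.
\<close>

primrec iter_dir_deriv ::
    "nat \<Rightarrow> (nat \<Rightarrow> 'a::euclidean_space) \<Rightarrow> ('a \<Rightarrow> 'b::euclidean_space) \<Rightarrow> 'a \<Rightarrow> 'b" where
  "iter_dir_deriv 0 y f = f"
| "iter_dir_deriv (Suc k) y f = dir_deriv (y k) (iter_dir_deriv k y f)"

text \<open>\<open>K \<times> (\<real>\<^sup>n)\<^sup>k\<close>, with \<open>k\<close>-tuples as extensional functions on \<open>{..<k}\<close>.\<close>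

definition dom_topology ::
    "'a::euclidean_space set \<Rightarrow> nat \<Rightarrow> ('a \<times> (nat \<Rightarrow> 'a)) topology" where
  "dom_topology K k =
     prod_topology (top_of_set K) (product_topology (\<lambda>_. euclidean) {..<k})"

definition maps_between :: "'a topology \<Rightarrow> 'b topology \<Rightarrow> ('a \<Rightarrow> 'b) set" where
  "maps_between X Y = {f \<in> extensional (topspace X). continuous_map X Y f}"

definition extends_deriv ::
    "'a::euclidean_space set \<Rightarrow> nat \<Rightarrow> ('a \<Rightarrow> 'b::euclidean_space) \<Rightarrow>
     ('a \<times> (nat \<Rightarrow> 'a) \<Rightarrow> 'b) \<Rightarrow> bool" where
  "extends_deriv K k f g \<longleftrightarrow>
     g \<in> maps_between (dom_topology K k) euclidean \<and>
     (\<forall>x \<in> interior K. \<forall>y \<in> (\<Pi>\<^sub>E i\<in>{..<k}. UNIV). g (x, y) = iter_dir_deriv k y f x)"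

definition smooth_maps ::
    "'a::euclidean_space set \<Rightarrow> ('a \<Rightarrow> 'b::euclidean_space) set" where
  "smooth_maps K =
     {f \<in> extensional K. continuous_on K f \<and> smooth_on_open (interior K) f \<and>
        (\<forall>k. \<exists>g. extends_deriv K k f g)}"

text \<open>
  The extension is unique when the interior of \<open>K\<close> is dense in \<open>K\<close>, in particular for convex
  \<open>K\<close> with non-empty interior; \<open>deriv_ext K\<close> is only meant for such \<open>K\<close>.
\<close>

definition deriv_ext ::
    "'a::euclidean_space set \<Rightarrow> nat \<Rightarrow> ('a \<Rightarrow> 'b::euclidean_space) \<Rightarrow> 'a \<times> (nat \<Rightarrow> 'a) \<Rightarrow> 'b" where
  "deriv_ext K k f = (THE g. extends_deriv K k f g)"

definition compact_open_topology :: "'a topology \<Rightarrow> 'b topology \<Rightarrow> ('a \<Rightarrow> 'b) topology" where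
  "compact_open_topology X Y =
     topology_generated_by
       {{f \<in> maps_between X Y. f ` Q \<subseteq> V} | Q V. compactin X Q \<and> openin Y V}"

definition smooth_topology ::
    "'a::euclidean_space set \<Rightarrow> ('a \<Rightarrow> 'b::euclidean_space) topology" where
  "smooth_topology K =
     topology_generated_by
       {{f \<in> smooth_maps K. deriv_ext K k f \<in> W} | k W.
          openin (compact_open_topology (dom_topology K k) euclidean) W}"

definition smooth_maps_vanishing ::
    "'a::euclidean_space set \<Rightarrow> ('a \<Rightarrow> 'b::euclidean_space) set" where
  "smooth_maps_vanishing K = {f \<in> smooth_maps K. \<forall>x \<in> frontier K. f x = 0}"

definition smooth_vanishing_topology ::
    "'a::euclidean_space set \<Rightarrow> ('a \<Rightarrow> 'b::euclidean_space) topology" where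
  "smooth_vanishing_topology K = subtopology (smooth_topology K) (smooth_maps_vanishing K)"

definition Diff_bd :: "'a::euclidean_space set \<Rightarrow> ('a \<Rightarrow> 'a) set" where
  "Diff_bd K =
     {\<phi>. bij_betw \<phi> K K \<and> \<phi> \<in> smooth_maps K \<and> restrict (inv_into K \<phi>) K \<in> smooth_maps K \<and>
         (\<forall>x \<in> frontier K. \<phi> x = x)}"

definition Omega :: "'a::euclidean_space set \<Rightarrow> ('a \<Rightarrow> 'a) set" where
  "Omega K = {(\<lambda>x\<in>K. \<phi> x - x) | \<phi>. \<phi> \<in> Diff_bd K}"

end

theory Submission
  imports Defs
begin

text \<open>
  Write \<open>\<phi>\<close> for an element of \<^term>\<open>Diff_bd K\<close>, \<open>\<gamma> = \<phi> - id\<close>, and let \<open>\<eta>\<close> vanish on the frontier of \<open>K\<close> and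
  be \<open>C\<^sup>1\<close>-close to \<open>\<gamma>\<close>. Then \<open>id + \<eta> = (id + \<zeta>) \<circ> \<phi>\<close> with \<open>\<zeta> = (\<eta> - \<gamma>) \<circ> \<phi>\<^sup>-\<^sup>1\<close>, and \<open>\<zeta>\<close>, extended
  by \<open>0\<close>, is a contraction of the whole space. By Banach's fixed point theorem \<open>id + \<zeta>\<close> is a bijection of
  the space which is the identity off \<open>K\<close>, so it restricts to a bijection of \<open>K\<close>; hence \<open>id + \<eta>\<close> is a
  bi-Lipschitz bijection of \<open>K\<close> fixing the frontier. The determinant of its derivative is bounded
  away from \<open>0\<close>, because the inverse is Lipschitz, and Cramer's rule bootstraps the smoothness of
  the inverse up to the boundary.
\<close>

section \<open>Maps with uniformly continuous derivatives\<close>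

text \<open>
  On a compact \<open>K\<close> with dense interior, a function on the interior extends continuously to \<open>K\<close>
  iff it is uniformly continuous. Uniform continuity of the derivatives therefore
  replaces the existence of continuous extensions, and is stable under products and composition.
\<close>

primrec uCk_on :: "nat \<Rightarrow> 'a::euclidean_space set \<Rightarrow> ('a \<Rightarrow> 'b::euclidean_space) \<Rightarrow> bool" where
  "uCk_on 0 U f \<longleftrightarrow> uniformly_continuous_on U f"
| "uCk_on (Suc k) U f \<longleftrightarrow> uniformly_continuous_on U f \<and>
     (\<forall>x\<in>U. f differentiable (at x)) \<and> (\<forall>v. uCk_on k U (\<lambda>x. frechet_derivative f (at x) v))"

lemma uCk_on_imp_uniformly_continuous_on: "uCk_on k U f \<Longrightarrow> uniformly_continuous_on U f"
  by (cases k) auto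

lemma uCk_on_imp_Ck_on: "uCk_on k U f \<Longrightarrow> Ck_on k U f"
  by (induction k arbitrary: f) (auto intro: uniformly_continuous_imp_continuous)

lemma uCk_on_SucD: "uCk_on (Suc k) U f \<Longrightarrow> uCk_on k U f"
proof (induction k arbitrary: f)
  case (Suc k)
  then show ?case by (metis uCk_on.simps(2))
qed simp

lemma uniformly_continuous_on_cong:
  fixes f g :: "'a::metric_space \<Rightarrow> 'b::metric_space"
  shows "(\<And>x. x \<in> U \<Longrightarrow> f x = g x) \<Longrightarrow> uniformly_continuous_on U f \<longleftrightarrow> uniformly_continuous_on U g"
  unfolding uniformly_continuous_on_def by (simp cong: ball_cong)

lemma uniformly_continuous_on_subset:
  fixes f :: "'a::metric_space \<Rightarrow> 'b::metric_space"
  shows "uniformly_continuous_on U f \<Longrightarrow> V \<subseteq> U \<Longrightarrow> uniformly_continuous_on V f"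
  unfolding uniformly_continuous_on_def by (meson subsetD)

lemma frechet_derivative_cong_open:
  assumes "open U" "x \<in> U" "\<And>y. y \<in> U \<Longrightarrow> f y = g y"
  shows "frechet_derivative f (at x) = frechet_derivative g (at x)"
proof -
  have "(f has_derivative D) (at x) \<longleftrightarrow> (g has_derivative D) (at x)" for D
    using assms has_derivative_transform_within_open[of f D x UNIV U g]
      has_derivative_transform_within_open[of g D x UNIV U f] by auto
  then show ?thesis
    unfolding frechet_derivative_def by simp
qed

lemma differentiable_cong_open:
  assumes "open U" "x \<in> U" "\<And>y. y \<in> U \<Longrightarrow> f y = g y"
  shows "f differentiable (at x) \<longleftrightarrow> g differentiable (at x)"
  using assms has_derivative_transform_within_open[of f _ x UNIV U g]
      has_derivative_transform_within_open[of g _ x UNIV U f]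
  unfolding differentiable_def by auto

lemma uCk_on_cong:
  assumes "open U"
  shows "(\<And>x. x \<in> U \<Longrightarrow> f x = g x) \<Longrightarrow> uCk_on k U f \<longleftrightarrow> uCk_on k U g"
proof (induction k arbitrary: f g)
  case 0
  then show ?case by (simp cong: uniformly_continuous_on_cong)
next
  case (Suc k)
  have "uCk_on k U (\<lambda>x. frechet_derivative f (at x) v) \<longleftrightarrow>
        uCk_on k U (\<lambda>x. frechet_derivative g (at x) v)" for v
    using frechet_derivative_cong_open[OF assms _ Suc.prems] by (intro Suc.IH) simp
  moreover have "f differentiable (at x) \<longleftrightarrow> g differentiable (at x)" if "x \<in> U" for x
    using differentiable_cong_open[OF assms that Suc.prems] .
  ultimately show ?case
    using uniformly_continuous_on_cong[of U f g] Suc.prems by auto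
qed

text \<open>Lets the closure proofs below name a derivative \<open>D\<close> explicitly. On the open
  set \<open>U\<close> the Frechet derivative is unique, so \<open>D\<close> and
  \<open>frechet_derivative f\<close> agree there, and agreement on an open set carries over to all
  higher derivatives.\<close>

lemma uCk_on_SucI:
  assumes "open U" "uniformly_continuous_on U f"
    and D: "\<And>x. x \<in> U \<Longrightarrow> (f has_derivative D x) (at x)"
    and "\<And>v. uCk_on k U (\<lambda>x. D x v)"
  shows "uCk_on (Suc k) U f"
proof -
  have "uCk_on k U (\<lambda>x. frechet_derivative f (at x) v)" for v
    using assms(4)[of v] uCk_on_cong[OF assms(1), of "\<lambda>x. D x v" "\<lambda>x. frechet_derivative f (at x) v" k]
      frechet_derivative_at[OF D] by simp
  with assms(2) D show ?thesis
    by (auto simp: differentiable_def)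
qed

lemma uCk_on_has_derivative:
  "uCk_on (Suc k) U f \<Longrightarrow> x \<in> U \<Longrightarrow> (f has_derivative frechet_derivative f (at x)) (at x)"
  by (simp add: frechet_derivative_works)

section \<open>Closure under sums, products, reciprocals and composition\<close>

lemma uCk_on_const: "open U \<Longrightarrow> uCk_on k U (\<lambda>x. c)"
proof (induction k arbitrary: c)
  case (Suc k)
  then show ?case
    by (intro uCk_on_SucI[where D = "\<lambda>x v. 0"]) (auto intro: uniformly_continuous_on_const)
qed (simp add: uniformly_continuous_on_const)

lemma uCk_on_bounded_linear:
  assumes "open U" "bounded_linear h" "uCk_on k U f"
  shows "uCk_on k U (\<lambda>x. h (f x))"
  using assms(3)
proof (induction k arbitrary: f)
  case 0
  then show ?case
    by (simp add: bounded_linear.uniformly_continuous_on[OF assms(2)])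
next
  case (Suc k)
  show ?case
  proof (rule uCk_on_SucI[OF assms(1)])
    show "uniformly_continuous_on U (\<lambda>x. h (f x))"
      using Suc.prems by (simp add: bounded_linear.uniformly_continuous_on[OF assms(2)])
    show "((\<lambda>x. h (f x)) has_derivative (\<lambda>v. h (frechet_derivative f (at x) v))) (at x)"
      if "x \<in> U" for x
      using bounded_linear.has_derivative[OF assms(2) uCk_on_has_derivative[OF Suc.prems that]] .
    show "uCk_on k U (\<lambda>x. h (frechet_derivative f (at x) v))" for v
      using Suc by simp
  qed
qed

lemma uCk_on_ident: "open U \<Longrightarrow> uCk_on k U (\<lambda>x. x)"
proof (cases k)
  case (Suc j)
  assume "open U"
  then show ?thesis unfolding Suc
    by (intro uCk_on_SucI[where D = "\<lambda>x v. v"])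
       (auto intro: uCk_on_const simp: uniformly_continuous_on_id)
qed (simp add: uniformly_continuous_on_id)

lemma uCk_on_add:
  assumes "open U" "uCk_on k U f" "uCk_on k U g"
  shows "uCk_on k U (\<lambda>x. f x + g x)"
  using assms(2,3)
proof (induction k arbitrary: f g)
  case 0
  then show ?case
    by (simp add: uniformly_continuous_on_add)
next
  case (Suc k)
  show ?case
  proof (rule uCk_on_SucI[OF assms(1)])
    show "uniformly_continuous_on U (\<lambda>x. f x + g x)"
      using Suc.prems by (simp add: uniformly_continuous_on_add)
    show "((\<lambda>x. f x + g x) has_derivative
        (\<lambda>v. frechet_derivative f (at x) v + frechet_derivative g (at x) v)) (at x)"
      if "x \<in> U" for x
      using has_derivative_add[OF uCk_on_has_derivative uCk_on_has_derivative] Suc.prems that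
      by blast
    show "uCk_on k U (\<lambda>x. frechet_derivative f (at x) v + frechet_derivative g (at x) v)" for v
      using Suc by simp
  qed
qed

lemma uCk_on_sum:
  assumes "open U" "\<And>i. i \<in> I \<Longrightarrow> uCk_on k U (f i)"
  shows "uCk_on k U (\<lambda>x. \<Sum>i\<in>I. f i x)"
  using assms(2)
  by (induction I rule: infinite_finite_induct)
     (auto intro!: uCk_on_add uCk_on_const assms(1))

text \<open>Products need not preserve uniform continuity on unbounded sets. For bounded
  \<open>U\<close> both factors extend continuously to the compact closure, where the product is
  uniformly continuous.\<close>

lemma uniformly_continuous_on_scaleR:
  fixes f :: "'a::euclidean_space \<Rightarrow> real" and g :: "'a \<Rightarrow> 'b::euclidean_space"
  assumes "bounded U" "uniformly_continuous_on U f" "uniformly_continuous_on U g"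
  shows "uniformly_continuous_on U (\<lambda>x. f x *\<^sub>R g x)"
proof -
  obtain f' where f': "uniformly_continuous_on (closure U) f'" "\<And>x. x \<in> U \<Longrightarrow> f x = f' x"
    using uniformly_continuous_on_extension_on_closure[OF assms(2)] by metis
  obtain g' where g': "uniformly_continuous_on (closure U) g'" "\<And>x. x \<in> U \<Longrightarrow> g x = g' x"
    using uniformly_continuous_on_extension_on_closure[OF assms(3)] by metis
  have "uniformly_continuous_on (closure U) (\<lambda>x. f' x *\<^sub>R g' x)"
    using f'(1) g'(1) assms(1)
    by (intro compact_uniformly_continuous continuous_on_scaleR)
       (auto simp: uniformly_continuous_imp_continuous)
  then have "uniformly_continuous_on U (\<lambda>x. f' x *\<^sub>R g' x)"
    using closure_subset uniformly_continuous_on_subset by blast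
  then show ?thesis
    using f'(2) g'(2) by (simp cong: uniformly_continuous_on_cong)
qed

lemma uCk_on_scaleR:
  fixes f :: "'a::euclidean_space \<Rightarrow> real" and g :: "'a \<Rightarrow> 'b::euclidean_space"
  assumes "open U" "bounded U" "uCk_on k U f" "uCk_on k U g"
  shows "uCk_on k U (\<lambda>x. f x *\<^sub>R g x)"
  using assms(3,4)
proof (induction k arbitrary: f g)
  case 0
  then show ?case
    by (simp add: uniformly_continuous_on_scaleR assms(2))
next
  case (Suc k)
  show ?case
  proof (rule uCk_on_SucI[OF assms(1)])
    show "uniformly_continuous_on U (\<lambda>x. f x *\<^sub>R g x)"
      using Suc.prems by (simp add: uniformly_continuous_on_scaleR assms(2))
    show "((\<lambda>x. f x *\<^sub>R g x) has_derivative
        (\<lambda>v. f x *\<^sub>R frechet_derivative g (at x) v + frechet_derivative f (at x) v *\<^sub>R g x)) (at x)"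
      if "x \<in> U" for x
      using has_derivative_scaleR[OF uCk_on_has_derivative uCk_on_has_derivative] Suc.prems that
      by blast
    \<comment> \<open>The product rule pairs a derivative of one factor with the other factor
      undifferentiated, so the latter's order is lowered by \<open>uCk_on_SucD\<close>.\<close>
    show "uCk_on k U (\<lambda>x. f x *\<^sub>R frechet_derivative g (at x) v + frechet_derivative f (at x) v *\<^sub>R g x)" for v
      using Suc.prems uCk_on_SucD[OF Suc.prems(1)] uCk_on_SucD[OF Suc.prems(2)]
      by (intro uCk_on_add assms(1) Suc.IH) auto
  qed
qed

lemma uCk_on_mult:
  fixes f g :: "'a::euclidean_space \<Rightarrow> real"
  assumes "open U" "bounded U" "uCk_on k U f" "uCk_on k U g"
  shows "uCk_on k U (\<lambda>x. f x * g x)"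
  using uCk_on_scaleR[OF assms] by simp

lemma uCk_on_prod:
  fixes f :: "'i \<Rightarrow> 'a::euclidean_space \<Rightarrow> real"
  assumes "open U" "bounded U" "\<And>i. i \<in> I \<Longrightarrow> uCk_on k U (f i)"
  shows "uCk_on k U (\<lambda>x. \<Prod>i\<in>I. f i x)"
  using assms(3)
  by (induction I rule: infinite_finite_induct)
     (auto intro!: uCk_on_mult uCk_on_const assms(1,2))

text \<open>The bound \<delta> passes to the continuous extension on the compact closure, so the
  reciprocal has no pole there.\<close>

lemma uniformly_continuous_on_inverse_bounded_below:
  fixes f :: "'a::euclidean_space \<Rightarrow> real"
  assumes "bounded U" "uniformly_continuous_on U f" "0 < \<delta>" "\<And>x. x \<in> U \<Longrightarrow> \<delta> \<le> \<bar>f x\<bar>"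
  shows "uniformly_continuous_on U (\<lambda>x. inverse (f x))"
proof -
  obtain f' where f': "uniformly_continuous_on (closure U) f'" "\<And>x. x \<in> U \<Longrightarrow> f x = f' x"
    using uniformly_continuous_on_extension_on_closure[OF assms(2)] by metis
  have cont: "continuous_on (closure U) f'"
    using f'(1) by (rule uniformly_continuous_imp_continuous)
  have "\<delta> \<le> \<bar>f' x\<bar>" if "x \<in> closure U" for x
    by (rule continuous_ge_on_closure[of U "\<lambda>x. \<bar>f' x\<bar>"])
       (use that assms(4) f'(2) cont in \<open>auto intro: continuous_intros\<close>)
  with cont have "uniformly_continuous_on (closure U) (\<lambda>x. inverse (f' x))"
    using assms(1,3)
    by (intro compact_uniformly_continuous continuous_on_inverse) fastforce+
  then have "uniformly_continuous_on U (\<lambda>x. inverse (f' x))"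
    using closure_subset uniformly_continuous_on_subset by blast
  then show ?thesis
    using f'(2) by (simp cong: uniformly_continuous_on_cong)
qed

text \<open>The derivative of 1/f is -(1/f) (Df) (1/f), whose regularity of order \<open>k\<close>
  follows from that of 1/f at the same order; the induction therefore closes with \<open>f\<close>
  fixed.\<close>

lemma uCk_on_inverse:
  fixes f :: "'a::euclidean_space \<Rightarrow> real"
  assumes "open U" "bounded U" "uCk_on k U f" "0 < \<delta>" "\<And>x. x \<in> U \<Longrightarrow> \<delta> \<le> \<bar>f x\<bar>"
  shows "uCk_on k U (\<lambda>x. inverse (f x))"
  using assms(3)
proof (induction k)
  case 0
  then show ?case
    by (simp add: uniformly_continuous_on_inverse_bounded_below[OF assms(2) _ assms(4,5)])
next
  case (Suc k)
  show ?case
  proof (rule uCk_on_SucI[OF assms(1)])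
    show "uniformly_continuous_on U (\<lambda>x. inverse (f x))"
      using Suc.prems
      by (simp add: uniformly_continuous_on_inverse_bounded_below[OF assms(2) _ assms(4,5)])
    show "((\<lambda>x. inverse (f x)) has_derivative
        (\<lambda>v. (-1) * (inverse (f x) * frechet_derivative f (at x) v * inverse (f x)))) (at x)"
      if "x \<in> U" for x
      using Deriv.has_derivative_inverse[OF _ uCk_on_has_derivative[OF Suc.prems that]]
        assms(4) assms(5)[OF that] by auto
    show "uCk_on k U (\<lambda>x. (-1) * (inverse (f x) * frechet_derivative f (at x) v * inverse (f x)))" for v
      using Suc.prems Suc.IH[OF uCk_on_SucD[OF Suc.prems]]
      by (intro uCk_on_mult uCk_on_const assms(1,2)) auto
  qed
qed

lemma linear_euclidean_expansion:
  fixes h :: "'a::euclidean_space \<Rightarrow> 'b::euclidean_space"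
  assumes "linear h"
  shows "h v = (\<Sum>b\<in>Basis. (v \<bullet> b) *\<^sub>R h b)"
proof -
  have "h v = h (\<Sum>b\<in>Basis. (v \<bullet> b) *\<^sub>R b)"
    by (simp add: euclidean_representation)
  then show ?thesis
    using assms by (simp add: linear_sum linear_scale)
qed

lemma uCk_on_compose:
  fixes f :: "'b::euclidean_space \<Rightarrow> 'c::euclidean_space" and g :: "'a::euclidean_space \<Rightarrow> 'b"
  assumes "open U" "open V" "bounded V" "uCk_on k U f" "uCk_on k V g" "g ` V \<subseteq> U"
  shows "uCk_on k V (\<lambda>x. f (g x))"
  using assms(4,5)
proof (induction k arbitrary: f)
  case 0
  then show ?case
    using uniformly_continuous_on_compose[of V g f] uniformly_continuous_on_subset[of U f, OF _ assms(6)]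
    by simp
next
  case (Suc k)
  \<comment> \<open>\<open>uCk_on\<close> controls derivatives only in fixed directions, but the
    chain rule applies Df to the moving direction Dg(x)v. Expanding that direction in the basis
    leaves scalar functions times derivatives of \<open>f\<close> in fixed directions.\<close>
  let ?D = "\<lambda>x v. \<Sum>b\<in>Basis. (frechet_derivative g (at x) v \<bullet> b) *\<^sub>R frechet_derivative f (at (g x)) b"
  show ?case
  proof (rule uCk_on_SucI[OF assms(2)])
    show "uniformly_continuous_on V (\<lambda>x. f (g x))"
      using Suc.prems uniformly_continuous_on_compose[of V g f] uniformly_continuous_on_subset[of U f, OF _ assms(6)]
      by simp
    show "((\<lambda>x. f (g x)) has_derivative ?D x) (at x)" if "x \<in> V" for x
    proof -
      have gx: "g x \<in> U" using that assms(6) by auto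
      have "((\<lambda>x. f (g x)) has_derivative
         (\<lambda>v. frechet_derivative f (at (g x)) (frechet_derivative g (at x) v))) (at x)"
        using has_derivative_compose[OF uCk_on_has_derivative[OF Suc.prems(2) that]
            uCk_on_has_derivative[OF Suc.prems(1) gx]] .
      then show ?thesis
        by (rule has_derivative_eq_rhs)
           (use Suc.prems(1) gx in \<open>intro ext linear_euclidean_expansion linear_frechet_derivative; auto\<close>)
    qed
    show "uCk_on k V (\<lambda>x. ?D x v)" for v
    proof (intro uCk_on_sum uCk_on_scaleR assms(2,3) uCk_on_bounded_linear[where h = "\<lambda>z. z \<bullet> _"])
      show "uCk_on k V (\<lambda>x. frechet_derivative f (at (g x)) b)" for b
        using Suc.prems(1) by (intro Suc.IH[OF _ uCk_on_SucD[OF Suc.prems(2)]]) auto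
    qed (use Suc.prems(2) in \<open>auto intro: bounded_linear_inner_left\<close>)
  qed
qed

section \<open>Iterated directional derivatives and smooth maps\<close>

lemma dir_deriv_eq_frechet_derivative:
  assumes "f differentiable (at x)"
  shows "dir_deriv y f x = frechet_derivative f (at x) y"
proof -
  have D: "(f has_derivative frechet_derivative f (at x)) (at (x + 0 *\<^sub>R y))"
    using assms by (simp add: frechet_derivative_works)
  have "((\<lambda>t. x + t *\<^sub>R y) has_derivative (\<lambda>t. t *\<^sub>R y)) (at 0)"
    by (auto intro!: derivative_eq_intros)
  from has_derivative_compose[OF this D]
  have "((\<lambda>t. f (x + t *\<^sub>R y)) has_derivative (\<lambda>t. t *\<^sub>R frechet_derivative f (at x) y)) (at 0)"
    using linear_frechet_derivative[OF assms] by (simp add: linear_scale)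
  then show ?thesis
    unfolding dir_deriv_def
    by (intro vector_derivative_at) (simp add: has_vector_derivative_def)
qed

lemma dir_deriv_cong_open:
  assumes "open U" "x \<in> U" "\<And>z. z \<in> U \<Longrightarrow> f z = g z"
  shows "dir_deriv y f x = dir_deriv y g x"
proof -
  have "open ((\<lambda>t. x + t *\<^sub>R y) -` U)"
    by (intro open_vimage assms(1) continuous_intros)
  then have "eventually (\<lambda>t. t \<in> (\<lambda>t. x + t *\<^sub>R y) -` U) (nhds 0)"
    using assms(2) by (intro eventually_nhds_in_open) auto
  then show ?thesis
    unfolding dir_deriv_def
    by (intro vector_derivative_cong_eq) (auto elim!: eventually_mono simp: assms(3))
qed

lemma iter_dir_deriv_cong_open:
  assumes "open U" "\<And>z. z \<in> U \<Longrightarrow> f z = g z"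
  shows "x \<in> U \<Longrightarrow> iter_dir_deriv k y f x = iter_dir_deriv k y g x"
  by (induction k arbitrary: x) (auto intro: dir_deriv_cong_open[OF assms(1)] assms(2))

lemma iter_dir_deriv_cong_directions:
  "(\<And>i. i < k \<Longrightarrow> y i = z i) \<Longrightarrow> iter_dir_deriv k y f = iter_dir_deriv k z f"
  by (induction k) auto

text \<open>The recursion of \<open>iter_dir_deriv\<close> splits off the direction differentiated
  last, that of \<open>uCk_on\<close> the one differentiated first. This moves between the
  two.\<close>

lemma iter_dir_deriv_Suc_shift:
  "iter_dir_deriv (Suc k) y f = iter_dir_deriv k (\<lambda>i. y (Suc i)) (dir_deriv (y 0) f)"
  by (induction k) auto

lemma iter_dir_deriv_Suc_frechet_derivative:
  assumes "open U" "\<And>z. z \<in> U \<Longrightarrow> f differentiable (at z)" "x \<in> U"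
  shows "iter_dir_deriv (Suc k) y f x =
    iter_dir_deriv k (\<lambda>i. y (Suc i)) (\<lambda>z. frechet_derivative f (at z) (y 0)) x"
  unfolding iter_dir_deriv_Suc_shift
  using assms by (intro iter_dir_deriv_cong_open[of U]) (auto simp: dir_deriv_eq_frechet_derivative)

text \<open>Linearity in the function passes through one Frechet derivative at a time. It serves to
  expand the first direction of an iterated derivative in the basis.\<close>

lemma iter_dir_deriv_linear_combination:
  assumes "open U" "\<And>b. b \<in> B \<Longrightarrow> Ck_on k U (F b)" "x \<in> U"
  shows "iter_dir_deriv k y (\<lambda>x. \<Sum>b\<in>B. c b *\<^sub>R F b x) x = (\<Sum>b\<in>B. c b *\<^sub>R iter_dir_deriv k y (F b) x)"
  using assms(2)
proof (induction k arbitrary: y F)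
  case (Suc k)
  let ?D = "\<lambda>b z. frechet_derivative (F b) (at z)"
  have D: "((\<lambda>x. \<Sum>b\<in>B. c b *\<^sub>R F b x) has_derivative (\<lambda>v. \<Sum>b\<in>B. c b *\<^sub>R ?D b z v)) (at z)"
    if "z \<in> U" for z
    using Suc.prems that
    by (intro has_derivative_sum has_derivative_scaleR_right) (simp add: frechet_derivative_works)
  have "iter_dir_deriv (Suc k) y (\<lambda>x. \<Sum>b\<in>B. c b *\<^sub>R F b x) x =
     iter_dir_deriv k (\<lambda>i. y (Suc i))
       (\<lambda>z. frechet_derivative (\<lambda>x. \<Sum>b\<in>B. c b *\<^sub>R F b x) (at z) (y 0)) x"
    using D assms(3)
    by (intro iter_dir_deriv_Suc_frechet_derivative[OF assms(1)]) (auto simp: differentiable_def)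
  also have "\<dots> = iter_dir_deriv k (\<lambda>i. y (Suc i)) (\<lambda>z. \<Sum>b\<in>B. c b *\<^sub>R ?D b z (y 0)) x"
    using assms(3)
    by (intro iter_dir_deriv_cong_open[OF assms(1)]) (simp_all add: frechet_derivative_at[OF D, symmetric])
  also have "\<dots> = (\<Sum>b\<in>B. c b *\<^sub>R iter_dir_deriv k (\<lambda>i. y (Suc i)) (\<lambda>z. ?D b z (y 0)) x)"
    using Suc.prems by (intro Suc.IH) auto
  also have "\<dots> = (\<Sum>b\<in>B. c b *\<^sub>R iter_dir_deriv (Suc k) y (F b) x)"
    using Suc.prems assms(3)
    by (intro sum.cong refl arg_cong2[where f = scaleR]
        iter_dir_deriv_Suc_frechet_derivative[OF assms(1), symmetric]) auto
  finally show ?case .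
qed simp

lemma uCk_on_if_iter_dir_deriv_uniformly_continuous:
  assumes "open U" "smooth_on_open U f"
    and "\<And>k y. uniformly_continuous_on U (iter_dir_deriv k y f)"
  shows "uCk_on k U f"
  using assms(2,3)
proof (induction k arbitrary: f)
  case 0
  show ?case using 0(2)[of 0] by simp
next
  case (Suc k)
  have diff: "f differentiable (at x)" if "x \<in> U" for x
  proof -
    have "Ck_on (Suc 0) U f" using Suc.prems(1) unfolding smooth_on_open_def by blast
    then show ?thesis using that by simp
  qed
  have "uCk_on k U (\<lambda>x. frechet_derivative f (at x) v)" for v
  proof (rule Suc.IH)
    have "Ck_on j U (\<lambda>x. frechet_derivative f (at x) v)" for j
      using Suc.prems(1) Ck_on.simps(2)[of j U f] unfolding smooth_on_open_def by blast
    then show "smooth_on_open U (\<lambda>x. frechet_derivative f (at x) v)"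
      unfolding smooth_on_open_def by blast
    fix j y
    \<comment> \<open>\<open>case_nat v y\<close> puts \<open>v\<close> in front of the directions
      \<open>y\<close>, so derivatives of Df(.)v are derivatives of \<open>f\<close> of one order
      higher.\<close>
    have "iter_dir_deriv (Suc j) (case_nat v y) f x =
       iter_dir_deriv j y (\<lambda>x. frechet_derivative f (at x) v) x" if "x \<in> U" for x
      using iter_dir_deriv_Suc_frechet_derivative[OF assms(1) diff that, of j "case_nat v y"]
      by simp
    with Suc.prems(2)[of "Suc j" "case_nat v y"]
    show "uniformly_continuous_on U (iter_dir_deriv j y (\<lambda>x. frechet_derivative f (at x) v))"
      by (subst (asm) uniformly_continuous_on_cong)
  qed
  moreover have "uniformly_continuous_on U f" using Suc.prems(2)[of 0] by simp
  ultimately show ?case using diff by simp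
qed

section \<open>Continuous extension of iterated derivatives up to the boundary\<close>

lemma topspace_dom_topology: "topspace (dom_topology K k) = K \<times> (\<Pi>\<^sub>E i\<in>{..<k}. UNIV)"
  by (simp add: dom_topology_def)

lemma continuous_on_slice:
  assumes "continuous_map (dom_topology K k) euclidean g" "y \<in> (\<Pi>\<^sub>E i\<in>{..<k}. UNIV)"
  shows "continuous_on K (\<lambda>x. g (x, y))"
proof -
  have "continuous_map (top_of_set K) (dom_topology K k) (\<lambda>x. (x, y))"
    unfolding dom_topology_def using assms(2)
    by (auto simp: continuous_map_pairwise o_def)
  from continuous_map_compose[OF this assms(1)] show ?thesis
    by (simp add: o_def)
qed

lemma continuous_map_scaleR:
  fixes g :: "'a \<Rightarrow> 'b::real_normed_vector"
  assumes "continuous_map X euclideanreal f" "continuous_map X euclidean g"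
  shows "continuous_map X euclidean (\<lambda>x. f x *\<^sub>R g x)"
  using assms by (simp add: continuous_map_atin tendsto_scaleR)

text \<open>Uniform continuity is known only for each fixed tuple of directions, whereas the
  extension must be jointly continuous in point and directions. Multilinearity bridges this: the
  extension is a finite sum of coordinates of the first direction times extensions one order lower,
  whose first direction is a fixed basis vector.\<close>

lemma extends_deriv_exists:
  assumes "compact K" "closure (interior K) = K" "\<And>j. uCk_on j (interior K) f"
  shows "\<exists>g. continuous_map (dom_topology K k) euclidean g \<and>
     (\<forall>x\<in>interior K. \<forall>y\<in>(\<Pi>\<^sub>E i\<in>{..<k}. UNIV). g (x, y) = iter_dir_deriv k y f x)"
  using assms(3)
proof (induction k arbitrary: f)
  case 0
  obtain f' where f': "uniformly_continuous_on K f'" "\<And>x. x \<in> interior K \<Longrightarrow> f x = f' x"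
    using uniformly_continuous_on_extension_on_closure[of "interior K" f]
      uCk_on_imp_uniformly_continuous_on[OF 0[of 0]] assms(2) by metis
  have "continuous_map (top_of_set K) euclidean f'"
    using f'(1) by (simp add: uniformly_continuous_imp_continuous)
  then have "continuous_map (dom_topology K 0) euclidean (f' \<circ> fst)"
    unfolding dom_topology_def using continuous_map_compose[OF continuous_map_fst] by blast
  then show ?case using f'(2) by (intro exI[of _ "f' \<circ> fst"] conjI) (assumption, simp)
next
  case (Suc k)
  let ?D = "\<lambda>b x. frechet_derivative f (at x) b"
  let ?shift = "\<lambda>y. \<lambda>i\<in>{..<k}. y (Suc i)"
  have D: "uCk_on j (interior K) (?D b)" for j b
    using Suc.prems[of "Suc j"] by simp
  have "\<exists>g. continuous_map (dom_topology K k) euclidean g \<and>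
     (\<forall>x\<in>interior K. \<forall>y\<in>(\<Pi>\<^sub>E i\<in>{..<k}. UNIV). g (x, y) = iter_dir_deriv k y (?D b) x)" for b
    using D by (rule Suc.IH)
  then obtain g where g: "\<And>b. continuous_map (dom_topology K k) euclidean (g b)"
    "\<And>b x y. x \<in> interior K \<Longrightarrow> y \<in> (\<Pi>\<^sub>E i\<in>{..<k}. UNIV) \<Longrightarrow>
       g b (x, y) = iter_dir_deriv k y (?D b) x"
    by metis
  define G where "G = (\<lambda>p. \<Sum>b\<in>Basis. (snd p 0 \<bullet> b) *\<^sub>R g b (fst p, ?shift (snd p)))"
  have proj: "continuous_map (dom_topology K (Suc k)) euclidean (\<lambda>p. snd p i)" if "i < Suc k" for i
    unfolding dom_topology_def using that by (intro continuous_map_prod_snd) auto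
  have "continuous_map (dom_topology K (Suc k)) (dom_topology K k) (\<lambda>p. (fst p, ?shift (snd p)))"
    unfolding dom_topology_def[of K k]
    by (auto simp: continuous_map_pairwise o_def continuous_map_componentwise
          intro: proj continuous_map_fst[of "top_of_set K", folded o_def])
       (simp add: dom_topology_def continuous_map_fst)
  from continuous_map_compose[OF this g(1)]
  have "continuous_map (dom_topology K (Suc k)) euclidean (\<lambda>p. g b (fst p, ?shift (snd p)))" for b
    by (simp add: o_def)
  moreover have "continuous_map (dom_topology K (Suc k)) euclideanreal (\<lambda>p. snd p 0 \<bullet> b)" for b
  proof -
    have "continuous_map euclidean euclideanreal (\<lambda>v. v \<bullet> b)"
      by (simp add: continuous_intros)
    from continuous_map_compose[OF proj[of 0] this] show ?thesis by (simp add: o_def)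
  qed
  ultimately have "continuous_map (dom_topology K (Suc k)) euclidean G"
    unfolding G_def by (intro continuous_map_sum continuous_map_scaleR) auto
  moreover have "G (x, y) = iter_dir_deriv (Suc k) y f x"
    if x: "x \<in> interior K" and y: "y \<in> (\<Pi>\<^sub>E i\<in>{..<Suc k}. UNIV)" for x y
  proof -
    have diff: "f differentiable (at z)" if "z \<in> interior K" for z
      using Suc.prems[of 1] that by simp
    have "iter_dir_deriv (Suc k) y f x = iter_dir_deriv k (\<lambda>i. y (Suc i)) (?D (y 0)) x"
      using iter_dir_deriv_Suc_frechet_derivative[OF open_interior diff x] .
    also have "\<dots> = iter_dir_deriv k (?shift y) (?D (y 0)) x"
      by (subst iter_dir_deriv_cong_directions[of k _ "?shift y"]) auto
    also have "\<dots> = iter_dir_deriv k (?shift y) (\<lambda>x. \<Sum>b\<in>Basis. (y 0 \<bullet> b) *\<^sub>R ?D b x) x"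
      using x diff
      by (intro iter_dir_deriv_cong_open[OF open_interior] linear_euclidean_expansion
          linear_frechet_derivative) auto
    also have "\<dots> = (\<Sum>b\<in>Basis. (y 0 \<bullet> b) *\<^sub>R iter_dir_deriv k (?shift y) (?D b) x)"
      using x D by (intro iter_dir_deriv_linear_combination[OF open_interior] uCk_on_imp_Ck_on) auto
    also have "\<dots> = G (x, y)"
      unfolding G_def using x by (auto intro!: sum.cong simp: g(2))
    finally show ?thesis by simp
  qed
  ultimately show ?case by blast
qed

text \<open>Frees the later arguments from constructing extensions. A slice of an extension at fixed
  directions is continuous on the compact \<open>K\<close>, hence uniformly continuous, and equals
  the iterated derivative on the interior. The converse is
  \<open>extends_deriv_exists\<close>.\<close>

lemma smooth_maps_iff_uCk_on:
  assumes "compact K" "closure (interior K) = K"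
  shows "f \<in> smooth_maps K \<longleftrightarrow>
    f \<in> extensional K \<and> continuous_on K f \<and> (\<forall>k. uCk_on k (interior K) f)"
proof
  assume f: "f \<in> smooth_maps K"
  have "uniformly_continuous_on (interior K) (iter_dir_deriv k y f)" for k y
  proof -
    obtain g where g: "extends_deriv K k f g"
      using f unfolding smooth_maps_def by blast
    \<comment> \<open>The extension is specified only at extensional tuples; restricting is harmless
      because \<open>iter_dir_deriv k\<close> reads only the first \<open>k\<close>
      directions.\<close>
    have y: "restrict y {..<k} \<in> (\<Pi>\<^sub>E i\<in>{..<k}. UNIV)" by simp
    have "uniformly_continuous_on K (\<lambda>x. g (x, restrict y {..<k}))"
      using g continuous_on_slice[OF _ y] assms(1)
      by (intro compact_uniformly_continuous) (auto simp: extends_deriv_def maps_between_def)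
    then have "uniformly_continuous_on (interior K) (\<lambda>x. g (x, restrict y {..<k}))"
      using interior_subset uniformly_continuous_on_subset by blast
    moreover have "g (x, restrict y {..<k}) = iter_dir_deriv k y f x" if "x \<in> interior K" for x
      using g y that iter_dir_deriv_cong_directions[of k "restrict y {..<k}" y f]
      unfolding extends_deriv_def by simp
    ultimately show ?thesis by (simp cong: uniformly_continuous_on_cong)
  qed
  with f show "f \<in> extensional K \<and> continuous_on K f \<and> (\<forall>k. uCk_on k (interior K) f)"
    unfolding smooth_maps_def
    by (auto intro: uCk_on_if_iter_dir_deriv_uniformly_continuous)
next
  assume f: "f \<in> extensional K \<and> continuous_on K f \<and> (\<forall>k. uCk_on k (interior K) f)"
  have "\<exists>g. extends_deriv K k f g" for k
  proof -
    obtain g where g: "continuous_map (dom_topology K k) euclidean g"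
      "\<And>x y. x\<in>interior K \<Longrightarrow> y\<in>(\<Pi>\<^sub>E i\<in>{..<k}. UNIV) \<Longrightarrow> g (x, y) = iter_dir_deriv k y f x"
      using extends_deriv_exists[OF assms, of f k] f by blast
    have "extends_deriv K k f (restrict g (topspace (dom_topology K k)))"
      unfolding extends_deriv_def maps_between_def
    proof (intro conjI ballI)
      have "continuous_map (dom_topology K k) euclidean (restrict g (topspace (dom_topology K k)))"
        using g(1) by (rule continuous_map_eq) simp
      then show "restrict g (topspace (dom_topology K k))
         \<in> {f \<in> extensional (topspace (dom_topology K k)). continuous_map (dom_topology K k) euclidean f}"
        by simp
    qed (use g(2) interior_subset[of K] in \<open>auto simp: topspace_dom_topology\<close>)
    then show ?thesis by blast
  qed
  with f show "f \<in> smooth_maps K"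
    unfolding smooth_maps_def smooth_on_open_def by (auto intro: uCk_on_imp_Ck_on)
qed

text \<open>At fixed directions two extensions differ by a continuous function vanishing on the
  dense interior. Off the domain both are \<open>undefined\<close>.\<close>

lemma extends_deriv_unique:
  assumes "closure (interior K) = K" "extends_deriv K k f g" "extends_deriv K k f h"
  shows "g = h"
proof
  fix p
  show "g p = h p"
  proof (cases "p \<in> topspace (dom_topology K k)")
    case False
    have "g \<in> extensional (topspace (dom_topology K k))" "h \<in> extensional (topspace (dom_topology K k))"
      using assms(2,3) by (simp_all add: extends_deriv_def maps_between_def)
    then show ?thesis
      using extensional_arb[of g, OF _ False] extensional_arb[of h, OF _ False] by metis
  next
    case True
    then obtain x y where p: "p = (x, y)" "x \<in> K" and y: "y \<in> (\<Pi>\<^sub>E i\<in>{..<k}. UNIV)"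
      by (auto simp: topspace_dom_topology)
    have "continuous_on (closure (interior K)) (\<lambda>x. g (x, y) - h (x, y))"
      unfolding assms(1) using assms(2,3) y
      by (intro continuous_on_diff continuous_on_slice) (auto simp: extends_deriv_def maps_between_def)
    then have "g (x, y) - h (x, y) = 0"
      by (rule continuous_constant_on_closure)
         (use assms p y in \<open>auto simp: extends_deriv_def\<close>)
    then show ?thesis by (simp add: p)
  qed
qed

lemma extends_deriv_deriv_ext:
  assumes "closure (interior K) = K" "f \<in> smooth_maps K"
  shows "extends_deriv K k f (deriv_ext K k f)"
proof -
  obtain g where g: "extends_deriv K k f g"
    using assms(2) unfolding smooth_maps_def by blast
  show ?thesis
    unfolding deriv_ext_def
    by (rule theI[of "extends_deriv K k f", OF g]) (rule extends_deriv_unique[OF assms(1) _ g])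
qed

section \<open>Lipschitz perturbations and inverse maps\<close>

text \<open>Turns control in the finitely many basis directions into an operator norm bound, at the
  cost of the factor \<open>DIM('a)\<close>.\<close>

lemma norm_linear_le_basis_bound:
  fixes h :: "'a::euclidean_space \<Rightarrow> 'b::euclidean_space" and e :: real
  assumes "linear h" "\<And>b. b \<in> Basis \<Longrightarrow> norm (h b) \<le> e"
  shows "norm (h v) \<le> DIM('a) * e * norm v"
proof -
  have "norm (h v) \<le> (\<Sum>b\<in>Basis. norm ((v \<bullet> b) *\<^sub>R h b))"
    by (subst linear_euclidean_expansion[OF assms(1)]) (rule norm_sum)
  also have "\<dots> \<le> (\<Sum>b\<in>(Basis::'a set). norm v * e)"
    by (intro sum_mono) (auto intro!: mult_mono assms(2) Basis_le_norm)
  finally show ?thesis by (simp add: ac_simps)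
qed

text \<open>The mean value inequality applies on the convex interior; continuity carries the
  Lipschitz bound to the closure.\<close>

lemma lipschitz_on_if_derivative_bounded:
  fixes f :: "'a::euclidean_space \<Rightarrow> 'b::euclidean_space" and e :: real
  assumes "convex K" "closure (interior K) = K" "continuous_on K f" "0 \<le> e"
    and D: "\<And>x. x \<in> interior K \<Longrightarrow> (f has_derivative D x) (at x)"
    and e: "\<And>x b. x \<in> interior K \<Longrightarrow> b \<in> Basis \<Longrightarrow> norm (D x b) \<le> e"
  shows "(DIM('a) * e)-lipschitz_on K f"
proof -
  have "(DIM('a) * e)-lipschitz_on (interior K) f"
  proof (rule lipschitz_onI)
    fix x y assume xy: "x \<in> interior K" "y \<in> interior K"
    have "norm (f x - f y) \<le> DIM('a) * e * norm (x - y)"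
    proof (rule differentiable_bound[OF convex_interior[OF assms(1)] _ _ xy])
      fix z assume z: "z \<in> interior K"
      then show "(f has_derivative D z) (at z within interior K)"
        using D has_derivative_at_withinI by blast
      show "onorm (D z) \<le> DIM('a) * e"
        using norm_linear_le_basis_bound[OF has_derivative_linear[OF D[OF z]] e[OF z]]
        by (intro onorm_le) simp
    qed
    then show "dist (f x) (f y) \<le> DIM('a) * e * dist x y" by (simp add: dist_norm)
  qed (simp add: assms(4))
  then have "(DIM('a) * e)-lipschitz_on (closure (interior K)) f"
    by (rule lipschitz_on_closure) (simp add: assms(2,3))
  then show ?thesis by (simp add: assms(2))
qed

text \<open>A uniformly continuous derivative on a bounded set is bounded.\<close>

lemma lipschitz_on_if_uCk_on:
  fixes f :: "'a::euclidean_space \<Rightarrow> 'b::euclidean_space"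
  assumes "compact K" "convex K" "closure (interior K) = K" "continuous_on K f"
    and f: "uCk_on (Suc 0) (interior K) f"
  obtains L where "0 < L" "L-lipschitz_on K f"
proof -
  let ?D = "\<lambda>x. frechet_derivative f (at x)"
  have bdd: "bounded (interior K)"
    using assms(1) bounded_interior compact_imp_bounded by blast
  have "\<exists>c. \<forall>x\<in>interior K. norm (?D x b) \<le> c" for b
  proof -
    have "uniformly_continuous_on (interior K) (\<lambda>x. ?D x b)"
      using f by simp
    then have "bounded ((\<lambda>x. ?D x b) ` interior K)"
      using bdd by (rule bounded_uniformly_continuous_image)
    then show ?thesis by (auto simp: bounded_iff)
  qed
  then obtain c where c: "\<And>b x. x \<in> interior K \<Longrightarrow> norm (?D x b) \<le> c b" by metis
  define e where "e = (\<Sum>b\<in>Basis. \<bar>c b\<bar>)"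
  have e: "norm (?D x b) \<le> e" if "x \<in> interior K" "b \<in> Basis" for x b
  proof -
    have "norm (?D x b) \<le> \<bar>c b\<bar>" using c[OF that(1), of b] by simp
    also have "\<dots> \<le> e" unfolding e_def using that(2) by (intro member_le_sum) auto
    finally show ?thesis .
  qed
  have "0 \<le> e" unfolding e_def by (simp add: sum_nonneg)
  have "(DIM('a) * e)-lipschitz_on K f"
    by (rule lipschitz_on_if_derivative_bounded[OF assms(2-4) \<open>0 \<le> e\<close> uCk_on_has_derivative[OF f] e])
  \<comment> \<open>Adding 1 makes the constant strictly positive, so that it can be divided by
    later.\<close>
  then have "(DIM('a) * e + 1)-lipschitz_on K f"
    by (rule lipschitz_on_le) simp
  moreover have "0 < DIM('a) * e + 1"
    using \<open>0 \<le> e\<close> by (simp add: add_nonneg_pos)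
  ultimately show ?thesis using that by blast
qed

text \<open>A segment from a point of \<open>K\<close> to a point outside meets the frontier, where
  \<open>f\<close> vanishes; the part up to that point already bounds \<open>f\<close> at its start
  with the same constant \<open>c\<close>.\<close>

lemma lipschitz_on_extend_by_zero:
  fixes f :: "'a::euclidean_space \<Rightarrow> 'b::real_normed_vector"
  assumes "closed K" "c-lipschitz_on K f" "\<And>x. x \<in> frontier K \<Longrightarrow> f x = 0"
  shows "c-lipschitz_on UNIV (\<lambda>x. if x \<in> K then f x else 0)"
proof (rule lipschitz_onI)
  let ?F = "\<lambda>x. if x \<in> K then f x else 0"
  show "0 \<le> c" using assms(2) by (rule lipschitz_on_nonneg)
  have mixed: "dist (f x) 0 \<le> c * dist x y" if "x \<in> K" "y \<notin> K" for x y
  proof -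
    have "closed_segment x y \<inter> frontier K \<noteq> {}"
      using that by (intro connected_Int_frontier) auto
    then obtain w where w: "w \<in> closed_segment x y" "w \<in> frontier K" by blast
    then have "w \<in> K" using assms(1) frontier_subset_closed by blast
    have "dist (f x) 0 \<le> c * dist x w"
      using lipschitz_onD[OF assms(2) that(1) \<open>w \<in> K\<close>] assms(3)[OF w(2)] by simp
    also have "\<dots> \<le> c * dist x y"
      using \<open>0 \<le> c\<close> dist_in_closed_segment[OF w(1)] by (intro mult_left_mono) (auto simp: dist_commute)
    finally show ?thesis .
  qed
  show "dist (?F x) (?F y) \<le> c * dist x y" for x y
    using mixed[of x y] mixed[of y x] lipschitz_onD[OF assms(2), of x y] \<open>0 \<le> c\<close>
    by (auto simp: dist_commute)
qed

lemma bij_betw_id_plus_contraction: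
  fixes f :: "'a::euclidean_space \<Rightarrow> 'a"
  assumes "closed K" "c-lipschitz_on K f" "c < 1" "\<And>x. x \<in> frontier K \<Longrightarrow> f x = 0"
  shows "bij_betw (\<lambda>x. x + f x) K K"
proof -
  define F where "F = (\<lambda>x. if x \<in> K then f x else 0)"
  have lip: "dist (F x) (F y) \<le> c * dist x y" for x y
    using lipschitz_onD[OF lipschitz_on_extend_by_zero[OF assms(1,2,4)]] unfolding F_def by simp
  have ex1: "\<exists>!x. x + F x = z" for z
  proof -
    \<comment> \<open>Solutions of x + F x = z are the fixed points of the contraction x \<mapsto> z
      - F x.\<close>
    have "\<exists>!x. z - F x = x"
    proof (rule banach_fix_type[of c])
      show "0 \<le> c" using assms(2) by (rule lipschitz_on_nonneg)
      show "\<forall>x y. dist (z - F x) (z - F y) \<le> c * dist x y"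
        using lip by (simp add: dist_norm norm_minus_commute)
    qed (rule assms(3))
    then show ?thesis by (simp add: algebra_simps eq_commute[of z])
  qed
  have outside: "x \<in> K" if "x + F x \<in> K" for x
    using that by (cases "x \<in> K") (auto simp: F_def)
  have inside: "x + F x \<in> K" if "x \<in> K" for x
  proof (rule ccontr)
    \<comment> \<open>Off \<open>K\<close> the map id + F is the identity, so x + F x would be a
      preimage of itself besides \<open>x\<close>; injectivity then puts x = x + F x outside
      \<open>K\<close>.\<close>
    assume n: "x + F x \<notin> K"
    then have "(x + F x) + F (x + F x) = x + F x" by (simp add: F_def)
    then have "x + F x = x" using ex1[of "x + F x"] by blast
    with n that show False by simp
  qed
  have "bij_betw (\<lambda>x. x + F x) K K"
    unfolding bij_betw_def
  proof
    show "inj_on (\<lambda>x. x + F x) K"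
    proof (rule inj_onI)
      fix x y assume "x + F x = y + F y"
      then show "x = y" using ex1[of "y + F y"] by blast
    qed
    show "(\<lambda>x. x + F x) ` K = K"
    proof (intro equalityI subsetI)
      fix z assume "z \<in> K"
      obtain x where "x + F x = z" using ex1 by blast
      with \<open>z \<in> K\<close> outside[of x] show "z \<in> (\<lambda>x. x + F x) ` K" by auto
    qed (use inside in blast)
  qed
  moreover have "bij_betw (\<lambda>x. x + F x) K K \<longleftrightarrow> bij_betw (\<lambda>x. x + f x) K K"
    by (rule bij_betw_cong) (simp add: F_def)
  ultimately show ?thesis by blast
qed

section \<open>Regularity of inverse maps: expansion bounds, determinants, Cramer's rule\<close>

lemma norm_le_derivative_if_expanding:
  fixes f :: "'a::real_normed_vector \<Rightarrow> 'b::real_normed_vector"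
  assumes "(f has_derivative D) (at x)" "open U" "x \<in> U"
    and exp: "\<And>z. z \<in> U \<Longrightarrow> norm (z - x) \<le> C * norm (f z - f x)"
  shows "norm v \<le> C * norm (D v)"
proof -
  have D: "(f has_derivative D) (at (x + 0 *\<^sub>R v))"
    using assms(1) by simp
  have "((\<lambda>t. x + t *\<^sub>R v) has_derivative (\<lambda>t. t *\<^sub>R v)) (at 0)"
    by (auto intro!: derivative_eq_intros)
  from has_derivative_compose[OF this D]
  have "((\<lambda>t. f (x + t *\<^sub>R v)) has_derivative (\<lambda>t. t *\<^sub>R D v)) (at 0)"
    using has_derivative_linear[OF assms(1)] by (simp add: linear_scale)
  then have "((\<lambda>t. norm (f (x + t *\<^sub>R v) - f x - t *\<^sub>R D v) / norm t) \<longlongrightarrow> 0) (at 0)"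
    by (simp add: has_derivative_at)
  moreover have "norm ((1 / t) *\<^sub>R (f (x + t *\<^sub>R v) - f x) - D v) =
      norm (f (x + t *\<^sub>R v) - f x - t *\<^sub>R D v) / norm t" if "t \<noteq> 0" for t
  proof -
    have "(1 / t) *\<^sub>R (f (x + t *\<^sub>R v) - f x) - D v = (1 / t) *\<^sub>R (f (x + t *\<^sub>R v) - f x - t *\<^sub>R D v)"
      using that by (simp add: scaleR_diff_right)
    then show ?thesis by (simp add: divide_inverse)
  qed
  ultimately have "((\<lambda>t. norm ((1 / t) *\<^sub>R (f (x + t *\<^sub>R v) - f x) - D v)) \<longlongrightarrow> 0) (at 0)"
    by (subst filterlim_cong[OF refl refl]) (auto simp: eventually_at_filter)
  then have lim: "((\<lambda>t. (1 / t) *\<^sub>R (f (x + t *\<^sub>R v) - f x)) \<longlongrightarrow> D v) (at 0)"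
    by (rule LIM_zero_cancel[OF tendsto_norm_zero_cancel])
  have "open ((\<lambda>t. x + t *\<^sub>R v) -` U)"
    by (intro open_vimage assms(2) continuous_intros)
  then have "eventually (\<lambda>t. t \<in> (\<lambda>t. x + t *\<^sub>R v) -` U - {0}) (at 0)"
    using assms(3) by (intro eventually_at_in_open) auto
  \<comment> \<open>The expansion bound, divided by the absolute value of \<open>t\<close>, bounds
    the difference quotients from below and survives in the limit.\<close>
  then have "eventually (\<lambda>t. norm v \<le> C * norm ((1 / t) *\<^sub>R (f (x + t *\<^sub>R v) - f x))) (at 0)"
  proof eventually_elim
    case (elim t)
    then have "\<bar>t\<bar> * norm v \<le> C * norm (f (x + t *\<^sub>R v) - f x)" "t \<noteq> 0"
      using exp[of "x + t *\<^sub>R v"] by auto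
    then show ?case by (simp add: pos_le_divide_eq mult.commute)
  qed
  moreover have "((\<lambda>t. C * norm ((1 / t) *\<^sub>R (f (x + t *\<^sub>R v) - f x))) \<longlongrightarrow> C * norm (D v)) (at 0)"
    by (intro tendsto_intros lim)
  ultimately show ?thesis
    by (intro tendsto_lowerbound[OF _ _ at_neq_bot])
qed

text \<open>A crude bound from the Leibniz formula. Applied to the derivative of the inverse map, it
  keeps the Jacobian determinant of the map itself away from 0.\<close>

lemma abs_det_le:
  fixes A :: "real^'n^'n" and C :: real
  assumes "\<And>i j. \<bar>A $ i $ j\<bar> \<le> C"
  shows "\<bar>det A\<bar> \<le> card {p. p permutes (UNIV::'n set)} * C ^ CARD('n)"
proof -
  have "\<bar>det A\<bar> \<le> (\<Sum>p | p permutes (UNIV::'n set). \<bar>of_int (sign p) * (\<Prod>i\<in>UNIV. A $ i $ p i)\<bar>)"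
    unfolding det_def by (rule sum_abs)
  also have "\<dots> \<le> (\<Sum>p | p permutes (UNIV::'n set). C ^ CARD('n))"
  proof (rule sum_mono)
    fix p :: "'n \<Rightarrow> 'n"
    have "\<bar>of_int (sign p) * (\<Prod>i\<in>UNIV. A $ i $ p i)\<bar> = (\<Prod>i\<in>UNIV. \<bar>A $ i $ p i\<bar>)"
      by (simp add: abs_mult abs_prod sign_def)
    also have "\<dots> \<le> (\<Prod>i\<in>(UNIV::'n set). C)"
      by (rule prod_mono) (simp add: assms)
    finally show "\<bar>of_int (sign p) * (\<Prod>i\<in>UNIV. A $ i $ p i)\<bar> \<le> C ^ CARD('n)" by simp
  qed
  finally show ?thesis by simp
qed

lemma uCk_on_det:
  fixes a :: "'n::finite \<Rightarrow> 'n \<Rightarrow> 'a::euclidean_space \<Rightarrow> real"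
  assumes "open U" "bounded U" "\<And>i j. uCk_on k U (a i j)"
  shows "uCk_on k U (\<lambda>x. det (\<chi> i j. a i j x))"
  unfolding det_def
  by (simp, intro uCk_on_sum uCk_on_mult uCk_on_const uCk_on_prod assms)

lemma uCk_on_vec_lambda:
  fixes h :: "'n::finite \<Rightarrow> 'a::euclidean_space \<Rightarrow> real"
  assumes "open U" "bounded U" "\<And>i. uCk_on k U (h i)"
  shows "uCk_on k U (\<lambda>x. \<chi> i. h i x)"
proof -
  have "(\<lambda>x. \<chi> i. h i x) = (\<lambda>x. \<Sum>i\<in>UNIV. h i x *\<^sub>R axis i 1)"
    using basis_expansion[of "\<chi> i. h i _"] by (simp add: scalar_mult_eq_scaleR)
  then show ?thesis
    by (simp only:) (intro uCk_on_sum uCk_on_scaleR uCk_on_const assms)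
qed

text \<open>A Lipschitz inverse makes \<phi> expanding, hence \<open>D\<close> injective and, in
  finite dimension, invertible. The same expansion bound gives the inverse \<open>G\<close> the
  constant \<open>C\<close>.\<close>

lemma has_derivative_inverse_lipschitz:
  fixes \<phi> \<psi> :: "'a::euclidean_space \<Rightarrow> 'a"
  assumes "open U" "\<psi> ` U \<subseteq> U" "\<And>y. y \<in> U \<Longrightarrow> \<phi> (\<psi> y) = y"
    "\<phi> ` U \<subseteq> U" "\<And>x. x \<in> U \<Longrightarrow> \<psi> (\<phi> x) = x" "C-lipschitz_on U \<psi>"
    and y: "y \<in> U" and D: "(\<phi> has_derivative D) (at (\<psi> y))"
  obtains G where "(\<psi> has_derivative G) (at y)" "\<And>v. D (G v) = v" "\<And>v. norm (G v) \<le> C * norm v"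
proof -
  have psi_y: "\<psi> y \<in> U" using y assms(2) by auto
  have lower: "norm v \<le> C * norm (D v)" for v
  proof (rule norm_le_derivative_if_expanding[OF D assms(1) psi_y])
    fix z assume "z \<in> U"
    then show "norm (z - \<psi> y) \<le> C * norm (\<phi> z - \<phi> (\<psi> y))"
      using lipschitz_onD[OF assms(6), of "\<phi> z" y] y assms(3-5) by (auto simp: dist_norm)
  qed
  have lin: "linear D" using D by (rule has_derivative_linear)
  have "inj D"
    using lower by (subst linear_injective_0[OF lin]) (metis norm_le_zero_iff norm_zero mult_zero_right)
  then obtain G where G: "linear G" "\<forall>x. G (D x) = x" "\<forall>x. D (G x) = x"
    using linear_injective_isomorphism[OF lin] by blast
  have "(\<psi> has_derivative G) (at y)"
  proof (rule has_derivative_inverse_basic[OF D _ _ _ assms(1) y assms(3)])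
    show "bounded_linear G" using G(1) by (simp add: linear_conv_bounded_linear)
    show "G \<circ> D = id" using G(2) by auto
    show "continuous (at y) \<psi>"
      using lipschitz_on_continuous_on[OF assms(6)] y assms(1)
      by (simp add: continuous_on_eq_continuous_at)
  qed
  moreover have "norm (G v) \<le> C * norm v" for v
    using lower[of "G v"] G(3) by simp
  ultimately show ?thesis using that G(3) by blast
qed

text \<open>Bootstrapping: the derivative of \<psi> at \<open>y\<close> is the inverse of D\<phi> at
  \<psi> y. By Cramer's rule its entries are built from those of D\<phi> composed with \<psi>, so
  order \<open>k\<close> for \<psi> yields order \<open>k\<close> for its derivative.\<close>

lemma uCk_on_inverse_map:
  fixes \<phi> \<psi> :: "real^'n \<Rightarrow> real^'n"
  assumes "open U" "bounded U" "\<psi> ` U \<subseteq> U" "\<And>y. y \<in> U \<Longrightarrow> \<phi> (\<psi> y) = y"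
    "\<phi> ` U \<subseteq> U" "\<And>x. x \<in> U \<Longrightarrow> \<psi> (\<phi> x) = x" "C-lipschitz_on U \<psi>"
    and phi: "\<And>k. uCk_on k U \<phi>"
  shows "uCk_on k U \<psi>"
proof -
  let ?D = "\<lambda>x. frechet_derivative \<phi> (at x)"
  define a where "a = (\<lambda>i j y. ?D (\<psi> y) (axis j 1) $ i)"
  have "\<exists>G. (\<psi> has_derivative G) (at y) \<and> (\<forall>v. ?D (\<psi> y) (G v) = v) \<and> (\<forall>v. norm (G v) \<le> C * norm v)"
    if "y \<in> U" for y
  proof -
    have "(\<phi> has_derivative ?D (\<psi> y)) (at (\<psi> y))"
      using that assms(3) by (intro uCk_on_has_derivative[OF phi[of "Suc 0"]]) auto
    from has_derivative_inverse_lipschitz[OF assms(1,3-7) that this] show ?thesis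
      by metis
  qed
  then obtain G where G: "\<And>y. y \<in> U \<Longrightarrow> (\<psi> has_derivative G y) (at y)"
    "\<And>y v. y \<in> U \<Longrightarrow> ?D (\<psi> y) (G y v) = v" "\<And>y v. y \<in> U \<Longrightarrow> norm (G y v) \<le> C * norm v"
    by metis
  have D_lin: "linear (?D (\<psi> y))" if "y \<in> U" for y
    using phi[of "Suc 0"] that assms(3) by (intro linear_frechet_derivative) auto
  have mat: "matrix (?D (\<psi> y)) = (\<chi> i j. a i j y)" for y
    by (simp add: matrix_def a_def)
  have "0 \<le> C" using assms(7) by (rule lipschitz_on_nonneg)
  \<comment> \<open>\<open>C + 1\<close> instead of \<open>C\<close> ensures that \<open>B\<close>
    is positive even when \<open>C\<close> is 0.\<close>
  define B where "B = card {p. p permutes (UNIV::'n set)} * (C + 1) ^ CARD('n)"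
  have "0 < B"
    unfolding B_def using \<open>0 \<le> C\<close>
    by (auto simp: card_gt_0_iff finite_permutations intro!: mult_pos_pos exI[of _ id] permutes_id)
  \<comment> \<open>The determinants of D\<phi> and of its inverse \<open>G y\<close> multiply to 1,
    and the latter is at most \<open>B\<close> in absolute value. The bound is uniform in
    \<open>y\<close>, as \<open>uCk_on_inverse\<close> demands.\<close>
  have det_lower: "1 / B \<le> \<bar>det (\<chi> i j. a i j y)\<bar>" if "y \<in> U" for y
  proof -
    have "linear (G y)" using G(1)[OF that] by (rule has_derivative_linear)
    have "(?D (\<psi> y)) \<circ> G y = id" using G(2)[OF that] by auto
    then have "matrix (?D (\<psi> y)) ** matrix (G y) = mat 1"
      using matrix_compose[OF \<open>linear (G y)\<close> D_lin[OF that]] by (simp add: matrix_id_mat_1)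
    then have "det (\<chi> i j. a i j y) * det (matrix (G y)) = 1"
      by (metis det_I det_mul mat)
    then have 1: "\<bar>det (\<chi> i j. a i j y)\<bar> * \<bar>det (matrix (G y))\<bar> = 1"
      by (metis abs_mult abs_one)
    have "\<bar>matrix (G y) $ i $ j\<bar> \<le> C + 1" for i j
    proof -
      have "\<bar>matrix (G y) $ i $ j\<bar> \<le> norm (G y (axis j 1))"
        by (simp add: matrix_def component_le_norm_cart)
      also have "\<dots> \<le> C + 1" using G(3)[OF that, of "axis j 1"] by simp
      finally show ?thesis .
    qed
    then have "\<bar>det (matrix (G y))\<bar> \<le> B" unfolding B_def by (rule abs_det_le)
    then have "1 \<le> \<bar>det (\<chi> i j. a i j y)\<bar> * B"
      using 1 by (metis abs_ge_zero mult_left_mono)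
    then show ?thesis using \<open>0 < B\<close> by (simp add: field_simps)
  qed
  \<comment> \<open>Cramer's numerator: the Jacobian matrix with column \<open>m\<close> replaced by
    \<open>v\<close>.\<close>
  define N where "N = (\<lambda>v m y. det (\<chi> i j. if j = m then v $ i else a i j y))"
  have cramer_G: "G y v = (\<chi> m. N v m y * inverse (det (\<chi> i j. a i j y)))" if "y \<in> U" for y v
  proof -
    have "(\<chi> i j. a i j y) *v G y v = v"
      using G(2)[OF that] fun_cong[OF matrix_vector_mul(2)[OF D_lin[OF that]], of "G y v"] by (simp add: mat)
    moreover have "det (\<chi> i j. a i j y) \<noteq> 0"
      using det_lower[OF that] \<open>0 < B\<close> by (metis abs_zero divide_pos_pos not_less zero_less_one)
    ultimately show ?thesis
      using cramer[of "\<chi> i j. a i j y" "G y v" v] by (simp add: N_def divide_inverse cong: if_cong)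
  qed
  show ?thesis
  proof (induction k)
    case 0
    then show ?case using lipschitz_on_uniformly_continuous[OF assms(7)] by simp
  next
    case (Suc k)
    \<comment> \<open>Here the induction hypothesis enters: \<open>a i j\<close> is an entry of
      D\<phi> composed with \<psi>, and \<psi> is known to have order \<open>k\<close>.\<close>
    have a: "uCk_on k U (a i j)" for i j
      unfolding a_def
    proof (rule uCk_on_bounded_linear[OF assms(1) bounded_linear_vec_nth])
      have "uCk_on k U (\<lambda>x. ?D x (axis j 1))"
        using phi[of "Suc k"] by simp
      then show "uCk_on k U (\<lambda>y. ?D (\<psi> y) (axis j 1))"
        using uCk_on_compose[OF assms(1,1,2) _ Suc.IH assms(3)] by blast
    qed
    have "uCk_on k U (N v m)" for v m
      unfolding N_def
    proof (rule uCk_on_det[OF assms(1,2)])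
      show "uCk_on k U (\<lambda>y. if j = m then v $ i else a i j y)" for i j
        by (cases "j = m") (simp_all add: a uCk_on_const assms(1))
    qed
    moreover have "uCk_on k U (\<lambda>y. inverse (det (\<chi> i j. a i j y)))"
      using \<open>0 < B\<close> det_lower
      by (intro uCk_on_inverse[of _ _ _ "1 / B"] uCk_on_det assms(1,2) a) auto
    ultimately have "uCk_on k U (\<lambda>y. \<chi> m. N v m y * inverse (det (\<chi> i j. a i j y)))" for v
      by (intro uCk_on_vec_lambda uCk_on_mult assms(1,2))
    then have "uCk_on k U (\<lambda>y. G y v)" for v
      using uCk_on_cong[OF assms(1), of "\<lambda>y. G y v"] cramer_G by simp
    then show ?case
      using lipschitz_on_uniformly_continuous[OF assms(7)] G(1)
      by (intro uCk_on_SucI[OF assms(1)]) auto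
  qed
qed

section \<open>Neighbourhoods in the smooth topology\<close>

lemma openin_smooth_topology_subbasic:
  assumes "closure (interior K) = K" "compactin (dom_topology K k) Q" "open V"
  shows "openin (smooth_topology K) {f \<in> smooth_maps K. deriv_ext K k f ` Q \<subseteq> V}"
proof -
  let ?M = "maps_between (dom_topology K k) euclidean"
  have "openin (compact_open_topology (dom_topology K k) euclidean) {g \<in> ?M. g ` Q \<subseteq> V}"
    unfolding compact_open_topology_def
    by (rule topology_generated_by_Basis) (use assms(2,3) in auto)
  then have "openin (smooth_topology K) {f \<in> smooth_maps K. deriv_ext K k f \<in> {g \<in> ?M. g ` Q \<subseteq> V}}"
    unfolding smooth_topology_def by (intro topology_generated_by_Basis) blast
  moreover have "{f \<in> smooth_maps K. deriv_ext K k f \<in> {g \<in> ?M. g ` Q \<subseteq> V}} =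
      {f \<in> smooth_maps K. deriv_ext K k f ` Q \<subseteq> V}"
    using extends_deriv_deriv_ext[OF assms(1)] by (auto simp: extends_deriv_def)
  ultimately show ?thesis by metis
qed

text \<open>Subbasic sets only confine the image of a compact set to one open set. Closeness that is
  uniform over \<open>K\<close> comes from covering \<open>K\<close> by finitely many compact pieces
  on which the derivative of \<gamma> varies by less than \<open>e / 2\<close>, and confining each
  image to a ball of radius \<open>e / 2\<close>.\<close>

lemma smooth_topology_uniform_neighbourhood:
  assumes "compact K" "K \<noteq> {}" "closure (interior K) = K" "\<gamma> \<in> smooth_maps K"
    and y: "y \<in> (\<Pi>\<^sub>E i\<in>{..<k}. UNIV)" and "0 < e"
  obtains N where "openin (smooth_topology K) N" "\<gamma> \<in> N" "N \<subseteq> smooth_maps K"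
    "\<And>f x. f \<in> N \<Longrightarrow> x \<in> K \<Longrightarrow> dist (deriv_ext K k f (x, y)) (deriv_ext K k \<gamma> (x, y)) < e"
proof -
  let ?h = "\<lambda>x. deriv_ext K k \<gamma> (x, y)"
  have "continuous_on K ?h"
    using extends_deriv_deriv_ext[OF assms(3,4)] y
    by (intro continuous_on_slice) (auto simp: extends_deriv_def maps_between_def)
  then have "uniformly_continuous_on K ?h"
    using assms(1) by (rule compact_uniformly_continuous)
  then obtain d where d: "0 < d" "\<And>x x'. x \<in> K \<Longrightarrow> x' \<in> K \<Longrightarrow> dist x' x < d \<Longrightarrow> dist (?h x') (?h x) < e / 2"
    unfolding uniformly_continuous_on_def using half_gt_zero[OF \<open>0 < e\<close>] by metis
  obtain T where T: "finite T" "T \<subseteq> K" "K \<subseteq> (\<Union>t\<in>T. ball t (d / 2))"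
    using compactE_image[OF assms(1), of K "\<lambda>t. ball t (d / 2)"] d(1)
    by (metis UN_I centre_in_ball half_gt_zero open_ball subsetI)
  define Q where "Q = (\<lambda>t. (K \<inter> cball t (d / 2)) \<times> {y})"
  define N where "N = (\<Inter>t\<in>T. {f \<in> smooth_maps K. deriv_ext K k f ` Q t \<subseteq> ball (?h t) (e / 2)})"
  \<comment> \<open>An empty intersection would be all functions rather than a set of smooth
    maps.\<close>
  have "T \<noteq> {}" using T(3) assms(2) by auto
  have "compactin (dom_topology K k) (Q t)" for t
    unfolding dom_topology_def Q_def compactin_Times
    using y assms(1) by (auto simp: compactin_subtopology compact_Int_closed)
  then have "openin (smooth_topology K) N"
    unfolding N_def using T(1) \<open>T \<noteq> {}\<close>
    by (intro openin_INT2 openin_smooth_topology_subbasic assms(3)) auto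
  moreover have "\<gamma> \<in> N"
  proof -
    have "dist (?h t) (?h x) < e / 2" if "t \<in> T" "x \<in> K" "dist t x \<le> d / 2" for t x
      using d(2)[of x t] that T(2) d(1) by auto
    then show ?thesis
      unfolding N_def Q_def using assms(4) by auto
  qed
  moreover have "N \<subseteq> smooth_maps K" using \<open>T \<noteq> {}\<close> unfolding N_def by auto
  moreover have "dist (deriv_ext K k f (x, y)) (?h x) < e" if f: "f \<in> N" and x: "x \<in> K" for f x
  proof -
    obtain t where t: "t \<in> T" "dist t x < d / 2" using T(3) x by auto
    then have "(x, y) \<in> Q t" using x unfolding Q_def by simp
    then have "deriv_ext K k f (x, y) \<in> ball (?h t) (e / 2)"
      using f t(1) unfolding N_def by blast
    then have "dist (?h t) (deriv_ext K k f (x, y)) < e / 2" by (simp only: mem_ball)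
    moreover have "dist (?h t) (?h x) < e / 2"
      using d(2)[of x t] x t T(2) d(1) by auto
    ultimately show ?thesis
      by (metis dist_commute dist_triangle_half_l)
  qed
  ultimately show ?thesis using that by blast
qed

text \<open>The first derivative is determined by the basis directions, so intersecting one uniform
  neighbourhood per basis vector, each taken at the 1-tuple \<open>y b\<close>, is a finite
  operation.\<close>

lemma smooth_topology_C1_neighbourhood:
  assumes "compact K" "K \<noteq> {}" "closure (interior K) = K" "\<gamma> \<in> smooth_maps K" "0 < e"
  obtains N where "openin (smooth_topology K) N" "\<gamma> \<in> N" "N \<subseteq> smooth_maps K"
    "\<And>f x b. f \<in> N \<Longrightarrow> x \<in> interior K \<Longrightarrow> b \<in> Basis \<Longrightarrow>
       norm (frechet_derivative f (at x) b - frechet_derivative \<gamma> (at x) b) < e"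
proof -
  define y where "y = (\<lambda>b::'a. \<lambda>i\<in>{..<1::nat}. b)"
  have y: "y b \<in> (\<Pi>\<^sub>E i\<in>{..<1}. UNIV)" for b
    by (simp add: y_def)
  have first: "deriv_ext K 1 f (x, y b) = frechet_derivative f (at x) b"
    if f: "f \<in> smooth_maps K" and x: "x \<in> interior K" for f :: "'a \<Rightarrow> 'b" and x b
  proof -
    have "deriv_ext K 1 f (x, y b) = iter_dir_deriv 1 (y b) f x"
      using extends_deriv_deriv_ext[OF assms(3) f, of 1] x y unfolding extends_deriv_def by blast
    also have "\<dots> = dir_deriv b f x" by (simp add: y_def)
    also have "\<dots> = frechet_derivative f (at x) b"
    proof (rule dir_deriv_eq_frechet_derivative)
      have "uCk_on (Suc 0) (interior K) f"
        using f smooth_maps_iff_uCk_on[OF assms(1,3)] by blast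
      then show "f differentiable (at x)" using x by simp
    qed
    finally show ?thesis .
  qed
  have "\<exists>N. openin (smooth_topology K) N \<and> \<gamma> \<in> N \<and> N \<subseteq> smooth_maps K \<and>
      (\<forall>f\<in>N. \<forall>x\<in>K. dist (deriv_ext K 1 f (x, y b)) (deriv_ext K 1 \<gamma> (x, y b)) < e)" for b
    using smooth_topology_uniform_neighbourhood[OF assms(1-4) y assms(5)] by metis
  then obtain N where N: "\<And>b. openin (smooth_topology K) (N b)" "\<And>b. \<gamma> \<in> N b" "\<And>b. N b \<subseteq> smooth_maps K"
    "\<And>b f x. f \<in> N b \<Longrightarrow> x \<in> K \<Longrightarrow> dist (deriv_ext K 1 f (x, y b)) (deriv_ext K 1 \<gamma> (x, y b)) < e"
    by metis
  show ?thesis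
  proof (rule that[of "\<Inter>b\<in>Basis. N b"])
    show "openin (smooth_topology K) (\<Inter>b\<in>Basis. N b)"
      by (intro openin_INT2 N(1)) auto
    show "\<gamma> \<in> (\<Inter>b\<in>Basis. N b)" using N(2) by blast
    show sub: "(\<Inter>b\<in>Basis. N b) \<subseteq> smooth_maps K" using N(3) nonempty_Basis by blast
    fix f x and b :: 'a
    assume f: "f \<in> (\<Inter>b\<in>Basis. N b)" and x: "x \<in> interior K" and b: "b \<in> Basis"
    have "f \<in> smooth_maps K" using sub f by blast
    moreover have "dist (deriv_ext K 1 f (x, y b)) (deriv_ext K 1 \<gamma> (x, y b)) < e"
      using f x b interior_subset N(4) by blast
    ultimately show "norm (frechet_derivative f (at x) b - frechet_derivative \<gamma> (at x) b) < e"
      using first[OF _ x] assms(4) by (simp add: dist_norm)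
  qed
qed

section \<open>Elements of \<open>Omega K\<close> as displacements of diffeomorphisms\<close>

lemma Omega_eq:
  "Omega K = {\<eta> \<in> extensional K. (\<lambda>x\<in>K. x + \<eta> x) \<in> Diff_bd K}"
proof (intro equalityI subsetI)
  fix \<eta> assume "\<eta> \<in> Omega K"
  then obtain \<phi> where \<phi>: "\<phi> \<in> Diff_bd K" "\<eta> = (\<lambda>x\<in>K. \<phi> x - x)"
    unfolding Omega_def by blast
  \<comment> \<open>Extensionality is what allows \<phi> to be recovered from its displacement as a
    function on the whole type.\<close>
  have "\<phi> \<in> extensional K" using \<phi>(1) unfolding Diff_bd_def smooth_maps_def by blast
  then have "(\<lambda>x\<in>K. x + \<eta> x) = \<phi>"
    unfolding \<phi>(2) by (intro extensionalityI[of _ K]) auto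
  with \<phi> show "\<eta> \<in> {\<eta> \<in> extensional K. (\<lambda>x\<in>K. x + \<eta> x) \<in> Diff_bd K}" by simp
next
  fix \<eta> assume "\<eta> \<in> {\<eta> \<in> extensional K. (\<lambda>x\<in>K. x + \<eta> x) \<in> Diff_bd K}"
  moreover from this have "\<eta> = (\<lambda>x\<in>K. (\<lambda>x\<in>K. x + \<eta> x) x - x)"
    by (intro extensionalityI[of _ K]) auto
  ultimately show "\<eta> \<in> Omega K"
    unfolding Omega_def by blast
qed

text \<open>An interior point sent to the frontier would share its image with that fixed frontier
  point, against injectivity.\<close>

lemma interior_mapsto_if_fixes_frontier:
  assumes "closed K" "inj_on f K" "f ` K \<subseteq> K" "\<And>x. x \<in> frontier K \<Longrightarrow> f x = x"
  shows "f ` interior K \<subseteq> interior K"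
proof (rule image_subsetI, rule ccontr)
  fix x assume x: "x \<in> interior K" "f x \<notin> interior K"
  then have xK: "x \<in> K" "f x \<in> K" using assms(3) interior_subset by blast+
  then have "f x \<in> frontier K" using x(2) assms(1) by (simp add: frontier_def)
  then have "f (f x) = f x" by (rule assms(4))
  then have "f x = x" using xK assms(2) by (simp add: inj_on_eq_iff)
  with x show False by simp
qed

lemma smooth_maps_id_plus_iff:
  assumes "compact K" "closure (interior K) = K" "\<eta> \<in> extensional K"
  shows "(\<lambda>x\<in>K. x + \<eta> x) \<in> smooth_maps K \<longleftrightarrow> \<eta> \<in> smooth_maps K"
proof -
  let ?\<phi> = "\<lambda>x\<in>K. x + \<eta> x"
  have int: "x \<in> K" if "x \<in> interior K" for x using that interior_subset by blast
  have 1: "uCk_on k (interior K) ?\<phi> \<longleftrightarrow> uCk_on k (interior K) (\<lambda>x. x + \<eta> x)" for k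
    by (rule uCk_on_cong) (auto dest: int)
  have neg: "uCk_on k (interior K) (\<lambda>x. - x)" for k
    by (intro uCk_on_bounded_linear[where h = uminus] bounded_linear_minus bounded_linear_ident uCk_on_ident) auto
  have 2: "uCk_on k (interior K) (\<lambda>x. x + \<eta> x) \<longleftrightarrow> uCk_on k (interior K) \<eta>" for k
    using uCk_on_add[OF open_interior neg, where g = "\<lambda>x. x + \<eta> x"]
      uCk_on_add[OF open_interior uCk_on_ident[OF open_interior], where g = \<eta>] by auto
  have "continuous_on K ?\<phi> \<longleftrightarrow> continuous_on K (\<lambda>x. x + \<eta> x)"
    by (rule continuous_on_cong) auto
  also have "\<dots> \<longleftrightarrow> continuous_on K \<eta>"
    using continuous_on_add[OF continuous_on_id, of K \<eta>]
      continuous_on_diff[OF _ continuous_on_id, of K "\<lambda>x. x + \<eta> x"] by auto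
  finally show ?thesis
    using 1 2 assms(3) by (simp add: smooth_maps_iff_uCk_on[OF assms(1,2)])
qed

lemma Omega_subset_smooth_maps_vanishing:
  assumes "compact K" "closure (interior K) = K"
  shows "Omega K \<subseteq> smooth_maps_vanishing K"
proof
  fix \<eta> assume "\<eta> \<in> Omega K"
  then have \<eta>: "\<eta> \<in> extensional K" "(\<lambda>x\<in>K. x + \<eta> x) \<in> Diff_bd K"
    unfolding Omega_eq by blast+
  then have "\<eta> \<in> smooth_maps K"
    using smooth_maps_id_plus_iff[OF assms \<eta>(1)] unfolding Diff_bd_def by blast
  moreover have "\<eta> x = 0" if x: "x \<in> frontier K" for x
  proof -
    have "x \<in> K" using x assms(1) frontier_subset_compact by blast
    moreover have "(\<lambda>x\<in>K. x + \<eta> x) x = x" using \<eta>(2) x unfolding Diff_bd_def by blast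
    ultimately show ?thesis by simp
  qed
  ultimately show "\<eta> \<in> smooth_maps_vanishing K" unfolding smooth_maps_vanishing_def by blast
qed

lemma zero_in_Omega:
  assumes "compact K" "closure (interior K) = K"
  shows "(\<lambda>x\<in>K. 0) \<in> Omega K"
proof -
  have sub: "x \<in> K" if "x \<in> frontier K" for x
    using that assms(1) frontier_subset_compact by blast
  let ?i = "\<lambda>x\<in>K. x"
  have "continuous_on K (\<lambda>x\<in>K. 0::'a)"
    by (subst continuous_on_cong[of K K _ "\<lambda>x. 0"]) auto
  moreover have "uCk_on k (interior K) (\<lambda>x\<in>K. 0::'a)" for k
    by (rule iffD2[OF uCk_on_cong[OF open_interior] uCk_on_const[OF open_interior, where c = 0]])
       (use interior_subset[of K] in auto)
  ultimately have "(\<lambda>x\<in>K. 0::'a) \<in> smooth_maps K"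
    by (simp add: smooth_maps_iff_uCk_on[OF assms])
  moreover have id: "(\<lambda>x\<in>K. x + (\<lambda>x\<in>K. 0::'a) x) = ?i"
    by (rule restrict_ext) simp
  ultimately have sm: "?i \<in> smooth_maps K"
    using smooth_maps_id_plus_iff[OF assms, of "\<lambda>x\<in>K. 0"] by simp
  have bij: "bij_betw ?i K K" by (simp add: bij_betw_def inj_on_def)
  have "restrict (inv_into K ?i) K = ?i"
  proof (rule restrict_ext)
    fix x assume x: "x \<in> K"
    then show "inv_into K ?i x = x"
      using inv_into_f_f[OF bij_betw_imp_inj_on[OF bij] x] by simp
  qed
  with sm bij sub have "?i \<in> Diff_bd K" unfolding Diff_bd_def by auto
  then show ?thesis unfolding Omega_eq using id by simp
qed

text \<open>The constant \<open>1 / (2 * L)\<close> is chosen so that composing with the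
  \<open>L\<close>-Lipschitz inverse gives a contraction with factor 1/2. The new inverse then loses
  only a factor 2.\<close>

lemma id_plus_bij_if_lipschitz_close:
  fixes \<gamma> \<eta> :: "'a::euclidean_space \<Rightarrow> 'a"
  assumes "closed K"
    and bij: "bij_betw (\<lambda>x\<in>K. x + \<gamma> x) K K" (is "bij_betw ?\<phi> K K")
    and L: "0 < L" "L-lipschitz_on K (inv_into K (\<lambda>x\<in>K. x + \<gamma> x))"
    and close: "(1 / (2 * L))-lipschitz_on K (\<lambda>x. \<eta> x - \<gamma> x)"
    and zero: "\<And>x. x \<in> frontier K \<Longrightarrow> \<gamma> x = 0" "\<And>x. x \<in> frontier K \<Longrightarrow> \<eta> x = 0"
  shows "bij_betw (\<lambda>x\<in>K. x + \<eta> x) K K" (is "bij_betw ?\<phi>' K K")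
    and "(2 * L)-lipschitz_on K (inv_into K (\<lambda>x\<in>K. x + \<eta> x))"
proof -
  define \<psi> where "\<psi> = inv_into K ?\<phi>"
  have \<psi>: "\<psi> y \<in> K" "?\<phi> (\<psi> y) = y" if "y \<in> K" for y
    using bij that unfolding \<psi>_def
    by (auto simp: bij_betw_inv_into_right simp del: restrict_apply intro: bij_betwE[OF bij_betw_inv_into[OF bij], rule_format])
  have \<phi>: "?\<phi> x \<in> K" "\<psi> (?\<phi> x) = x" if "x \<in> K" for x
    using bij that unfolding \<psi>_def
    by (auto simp: bij_betw_inv_into_left simp del: restrict_apply intro: bij_betwE[OF bij, rule_format])
  define \<zeta> where "\<zeta> = (\<lambda>y. \<eta> (\<psi> y) - \<gamma> (\<psi> y))"
  have "(1 / (2 * L) * L)-lipschitz_on K (\<lambda>y. (\<lambda>x. \<eta> x - \<gamma> x) (\<psi> y))"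
  proof (rule lipschitz_on_compose2[where f = \<psi>])
    show "L-lipschitz_on K \<psi>" using L(2) by (simp add: \<psi>_def)
    show "(1 / (2 * L))-lipschitz_on (\<psi> ` K) (\<lambda>x. \<eta> x - \<gamma> x)"
      using lipschitz_on_subset[OF close] \<psi>(1) by blast
  qed
  then have lip: "(1 / 2)-lipschitz_on K \<zeta>"
    using L(1) by (simp add: \<zeta>_def)
  have \<zeta>0: "\<zeta> x = 0" if x: "x \<in> frontier K" for x
  proof -
    have "x \<in> K" using x assms(1) frontier_subset_closed by blast
    then have "?\<phi> x = x" using zero(1)[OF x] by simp
    \<comment> \<open>So \<zeta> is evaluated at a frontier point, where both \<eta> and \<gamma>
      vanish.\<close>
    then have "\<psi> x = x" using \<phi>(2)[OF \<open>x \<in> K\<close>] by metis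
    then show ?thesis using zero x by (simp add: \<zeta>_def)
  qed
  have "bij_betw (\<lambda>y. y + \<zeta> y) K K"
    using bij_betw_id_plus_contraction[OF assms(1) lip _ \<zeta>0] by simp
  from bij_betw_trans[OF bij this]
  have "bij_betw ((\<lambda>y. y + \<zeta> y) \<circ> ?\<phi>) K K" .
  moreover have "((\<lambda>y. y + \<zeta> y) \<circ> ?\<phi>) x = ?\<phi>' x" if "x \<in> K" for x
    using \<phi>(2)[OF that] that by (simp add: \<zeta>_def)
  ultimately show bij': "bij_betw ?\<phi>' K K"
    using bij_betw_cong[of K "(\<lambda>y. y + \<zeta> y) \<circ> ?\<phi>" ?\<phi>' K] by blast
  show "(2 * L)-lipschitz_on K (inv_into K ?\<phi>')"
  proof (rule lipschitz_onI)
    fix u v assume "u \<in> K" "v \<in> K"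
    define x y where "x = inv_into K ?\<phi>' u" and "y = inv_into K ?\<phi>' v"
    have xy: "x \<in> K" "y \<in> K"
      using \<open>u \<in> K\<close> \<open>v \<in> K\<close> bij_betwE[OF bij_betw_inv_into[OF bij']] unfolding x_def y_def by blast+
    have uv: "?\<phi>' x = u" "?\<phi>' y = v"
      using \<open>u \<in> K\<close> \<open>v \<in> K\<close> bij_betw_inv_into_right[OF bij'] unfolding x_def y_def by blast+
    \<comment> \<open>Comparing the images under the old and the new map gives dist x y \<le> L *
      dist u v + dist x y / 2; absorbing the last term yields \<open>2 * L\<close>.\<close>
    have "dist x y \<le> L * dist (?\<phi> x) (?\<phi> y)"
      using lipschitz_onD[OF L(2) \<phi>(1)[OF xy(1)] \<phi>(1)[OF xy(2)]] \<phi>(2)[OF xy(1)] \<phi>(2)[OF xy(2)]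
      by (simp only: \<psi>_def)
    also have "\<dots> \<le> L * (dist u v + dist (\<eta> x - \<gamma> x) (\<eta> y - \<gamma> y))"
    proof (rule mult_left_mono)
      have "?\<phi> x - ?\<phi> y = (u - v) - ((\<eta> x - \<gamma> x) - (\<eta> y - \<gamma> y))"
        using uv xy by (simp add: algebra_simps)
      then show "dist (?\<phi> x) (?\<phi> y) \<le> dist u v + dist (\<eta> x - \<gamma> x) (\<eta> y - \<gamma> y)"
        unfolding dist_norm by (metis norm_triangle_ineq4)
    qed (use L(1) in simp)
    also have "\<dots> \<le> L * (dist u v + 1 / (2 * L) * dist x y)"
      using L(1) lipschitz_onD[OF close xy] by (intro mult_left_mono add_left_mono) auto
    also have "\<dots> = L * dist u v + dist x y / 2"
      using L(1) by (simp add: field_simps)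
    finally show "dist (inv_into K ?\<phi>' u) (inv_into K ?\<phi>' v) \<le> 2 * L * dist u v"
      unfolding x_def[symmetric] y_def[symmetric] by simp
  qed (use L(1) in simp)
qed

text \<open>Both maps preserve the interior, because they are injective and fix the frontier, so
  \<open>uCk_on_inverse_map\<close> applies there. The Lipschitz bound on all of \<open>K\<close>
  supplies continuity up to the frontier.\<close>

lemma restrict_inv_in_smooth_maps:
  fixes \<phi> :: "real^'n \<Rightarrow> real^'n"
  assumes "compact K" "closure (interior K) = K" "\<phi> \<in> smooth_maps K" "bij_betw \<phi> K K"
    and fixed: "\<And>x. x \<in> frontier K \<Longrightarrow> \<phi> x = x" and lip: "C-lipschitz_on K (inv_into K \<phi>)"
  shows "restrict (inv_into K \<phi>) K \<in> smooth_maps K"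
proof -
  let ?\<psi> = "inv_into K \<phi>"
  have closed: "closed K" using assms(1) by (rule compact_imp_closed)
  have bdd: "bounded (interior K)"
    using assms(1) bounded_interior compact_imp_bounded by blast
  have int: "x \<in> K" if "x \<in> interior K" for x using that interior_subset by blast
  have fr: "x \<in> K" if "x \<in> frontier K" for x using that closed frontier_subset_closed by blast
  have bij': "bij_betw ?\<psi> K K" using assms(4) by (rule bij_betw_inv_into)
  have left: "?\<psi> (\<phi> x) = x" if "x \<in> K" for x
    using assms(4) that by (rule bij_betw_inv_into_left)
  have \<phi>_int: "\<phi> ` interior K \<subseteq> interior K"
    using assms(4) by (intro interior_mapsto_if_fixes_frontier closed fixed) (auto simp: bij_betw_def)
  have \<psi>_int: "?\<psi> ` interior K \<subseteq> interior K"
  proof (rule interior_mapsto_if_fixes_frontier[OF closed])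
    show "inj_on ?\<psi> K" "?\<psi> ` K \<subseteq> K" using bij' by (auto simp: bij_betw_def)
    show "?\<psi> x = x" if "x \<in> frontier K" for x
      using left[OF fr[OF that]] fixed[OF that] by simp
  qed
  have lip': "C-lipschitz_on (interior K) ?\<psi>"
    using lip interior_subset by (rule lipschitz_on_subset)
  have "uCk_on k (interior K) \<phi>" for k
    using assms(3) smooth_maps_iff_uCk_on[OF assms(1,2)] by blast
  then have "uCk_on k (interior K) ?\<psi>" for k
    using bij_betw_inv_into_right[OF assms(4) int]
    by (intro uCk_on_inverse_map[OF open_interior bdd \<psi>_int _ \<phi>_int left[OF int] lip'])
  then have "uCk_on k (interior K) (restrict ?\<psi> K)" for k
    using uCk_on_cong[OF open_interior, of K "restrict ?\<psi> K" ?\<psi> k] int by simp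
  moreover have "continuous_on K (restrict ?\<psi> K)"
    using lipschitz_on_continuous_on[OF lip] by (subst continuous_on_cong[of K K _ ?\<psi>]) auto
  ultimately show ?thesis
    by (simp add: smooth_maps_iff_uCk_on[OF assms(1,2)])
qed

theorem mainTheorem5:
  fixes K :: "(real ^ 'n) set"
  assumes "compact K" and "convex K" and "interior K \<noteq> {}"
  shows "openin (smooth_vanishing_topology K) (Omega K) \<and> (\<lambda>x\<in>K. 0) \<in> Omega K"
proof
  have closed: "closed K" using assms(1) by (rule compact_imp_closed)
  have dense: "closure (interior K) = K"
    using convex_closure_interior[OF assms(2,3)] closed by simp
  have nonempty: "K \<noteq> {}" using assms(3) by auto
  show "(\<lambda>x\<in>K. 0) \<in> Omega K" using assms(1) dense by (rule zero_in_Omega)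
  have "\<exists>T. openin (smooth_vanishing_topology K) T \<and> \<gamma> \<in> T \<and> T \<subseteq> Omega K"
    if \<gamma>: "\<gamma> \<in> Omega K" for \<gamma>
  proof -
    let ?\<phi> = "\<lambda>x\<in>K. x + \<gamma> x"
    let ?\<psi> = "inv_into K ?\<phi>"
    have \<gamma>_van: "\<gamma> \<in> smooth_maps_vanishing K"
      using \<gamma> Omega_subset_smooth_maps_vanishing[OF assms(1) dense] by blast
    then have \<gamma>_sm: "\<gamma> \<in> smooth_maps K" and \<gamma>_0: "\<And>x. x \<in> frontier K \<Longrightarrow> \<gamma> x = 0"
      unfolding smooth_maps_vanishing_def by blast+
    have \<phi>: "bij_betw ?\<phi> K K" "restrict ?\<psi> K \<in> smooth_maps K"
      using \<gamma> unfolding Omega_eq Diff_bd_def by blast+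
    obtain L where L: "0 < L" "L-lipschitz_on K (restrict ?\<psi> K)"
      using lipschitz_on_if_uCk_on[OF assms(1,2) dense] \<phi>(2)
      unfolding smooth_maps_iff_uCk_on[OF assms(1) dense] by blast
    then have L_lip: "L-lipschitz_on K ?\<psi>"
      unfolding lipschitz_on_def by simp
    \<comment> \<open>The division by the dimension cancels the factor in
      \<open>lipschitz_on_if_derivative_bounded\<close>, so the difference \<eta> - \<gamma> gets
      exactly the constant \<open>1 / (2 * L)\<close>.\<close>
    define e where "e = 1 / (2 * L) / DIM(real^'n)"
    have e: "0 < e" "DIM(real^'n) * e = 1 / (2 * L)"
      using L(1) by (simp_all add: e_def del: DIM_cart)
    obtain N where N: "openin (smooth_topology K) N" "\<gamma> \<in> N" "N \<subseteq> smooth_maps K"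
      "\<And>f x b. f \<in> N \<Longrightarrow> x \<in> interior K \<Longrightarrow> b \<in> Basis \<Longrightarrow>
       norm (frechet_derivative f (at x) b - frechet_derivative \<gamma> (at x) b) < e"
      using smooth_topology_C1_neighbourhood[OF assms(1) nonempty dense \<gamma>_sm e(1)] by blast
    \<comment> \<open>\<open>N\<close> constrains first derivatives only; smoothness of all orders
      for the inverse comes from that of \<eta> itself by bootstrapping.\<close>
    have "\<eta> \<in> Omega K" if "\<eta> \<in> N" and van: "\<eta> \<in> smooth_maps_vanishing K" for \<eta>
    proof -
      let ?\<phi>' = "\<lambda>x\<in>K. x + \<eta> x"
      have \<eta>_sm: "\<eta> \<in> smooth_maps K" and \<eta>_0: "\<And>x. x \<in> frontier K \<Longrightarrow> \<eta> x = 0"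
        using van unfolding smooth_maps_vanishing_def by blast+
      have ext: "\<eta> \<in> extensional K" using \<eta>_sm unfolding smooth_maps_def by blast
      have cont: "continuous_on K \<eta>" "continuous_on K \<gamma>"
        using \<eta>_sm \<gamma>_sm unfolding smooth_maps_def by blast+
      have C1: "uCk_on (Suc 0) (interior K) \<eta>" "uCk_on (Suc 0) (interior K) \<gamma>"
        using \<eta>_sm \<gamma>_sm unfolding smooth_maps_iff_uCk_on[OF assms(1) dense] by blast+
      have close: "(1 / (2 * L))-lipschitz_on K (\<lambda>x. \<eta> x - \<gamma> x)"
        unfolding e(2)[symmetric]
      proof (rule lipschitz_on_if_derivative_bounded[OF assms(2) dense continuous_on_diff[OF cont]])
        show "((\<lambda>x. \<eta> x - \<gamma> x) has_derivative
            (\<lambda>v. frechet_derivative \<eta> (at x) v - frechet_derivative \<gamma> (at x) v)) (at x)"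
          if "x \<in> interior K" for x
          by (intro has_derivative_diff uCk_on_has_derivative[OF C1(1) that]
              uCk_on_has_derivative[OF C1(2) that])
        show "norm (frechet_derivative \<eta> (at x) b - frechet_derivative \<gamma> (at x) b) \<le> e"
          if "x \<in> interior K" "b \<in> Basis" for x b
          using N(4)[OF \<open>\<eta> \<in> N\<close> that] by simp
      qed (use e(1) in simp)
      have bij: "bij_betw ?\<phi>' K K" and lip: "(2 * L)-lipschitz_on K (inv_into K ?\<phi>')"
        using id_plus_bij_if_lipschitz_close[OF closed \<phi>(1) L(1) L_lip close \<gamma>_0 \<eta>_0] by blast+
      have fixed: "?\<phi>' x = x" if x: "x \<in> frontier K" for x
        using \<eta>_0[OF x] x closed frontier_subset_closed by auto
      have sm: "?\<phi>' \<in> smooth_maps K"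
        using \<eta>_sm smooth_maps_id_plus_iff[OF assms(1) dense ext] by blast
      have "restrict (inv_into K ?\<phi>') K \<in> smooth_maps K"
        by (rule restrict_inv_in_smooth_maps[OF assms(1) dense sm bij fixed lip])
      with sm bij fixed have "?\<phi>' \<in> Diff_bd K" unfolding Diff_bd_def by blast
      with ext show ?thesis unfolding Omega_eq by blast
    qed
    moreover have "openin (smooth_vanishing_topology K) (N \<inter> smooth_maps_vanishing K)"
      unfolding smooth_vanishing_topology_def using N(1) by (auto simp: openin_subtopology)
    ultimately show ?thesis using N(2) \<gamma>_van by (intro exI[of _ "N \<inter> smooth_maps_vanishing K"]) blast
  qed
  then show "openin (smooth_vanishing_topology K) (Omega K)"
    by (subst openin_subopen) blast
qed

end
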